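(* Let $\theta,\lambda,\Delta>0$, $a=\lambda\Delta$, and let $G_\theta$ be a homogeneous Gamma process on $[0,\infty)$. Set $$Y_{\theta a}:=e^{-a}\int_0^{\Delta}e^{\lambda y}\,G_\theta(d\lambda y).$$ Then $G_\theta(a)=\int_0^{\Delta}G_\theta(d\lambda y)\overset{d}{=}T_{\theta a}$. Let $M_{\theta a}:=\int_0^1 x\,P_{\theta aF_a}(dx)$ be the Dirichlet process mean functional based on the shape parameter $\theta aF_a$. Then: (i) One has the equality in joint distribution $$(G_\theta(a),\,Y_{\theta a})\overset{d}{=}(T_{\theta a},\,T_{\theta a}M_{\theta a}),$$ where $M_{\theta a}$ is independent of $T_{\theta a}$. Furthermore $e^{-a}\le M_{\theta a}\le 1$ almost surely. (ii) $\int_0^{\Delta}(1-e^{-\lambda(\Delta-y)})\,G_\theta(d\lambda y)=G_\theta(a)-Y_{\theta a}\overset{d}{=}T_{\theta a}[1-M_{\theta a}]$. (iii) $(G_\theta(a)-Y_{\theta a},\,Y_{\theta a})\overset{d}{=}(T_{\theta a}[1-M_{\theta a}],\,T_{\theta a}M_{\theta a})$.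
   Context: $T_c$ denotes a Gamma random variable with shape $c$ and scale $1$. $G_\theta$ is the subordinator with $E[e^{-\omega G_\theta(t)}]=(1+\omega)^{-\theta t}$; we also write $G_\theta$ for the associated random measure, and $\int_0^{t} g(y)\,G_\theta(d\lambda y):=\int_0^{\lambda t}g(s/\lambda)\,G_\theta(ds)$. $F_a$ is the probability distribution on $[e^{-a},1]$ with cdf $F_a(y)=(\log y+a)/a$, i.e. with density $1/(ay)$ there. For $c>0$ and a probability measure $H$, $G_{cH}$ denotes the Gamma random measure with shape measure $cH$ (independent $\mathrm{Gamma}(cH(A),1)$ masses on disjoint sets $A$), and the Dirichlet process with shape $cH$ is $P_{cH}(dx)=G_{cH}(dx)/G_{cH}(\mathcal X)$, where $\mathcal X$ is the whole space; the total mass $G_{cH}(\mathcal X)\overset d= T_c$ is independent of $P_{cH}$. *)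

theory Defs
  imports "HOL-Probability.Probability"
begin

definition gamma_density :: "real \<Rightarrow> real \<Rightarrow> real" where
  "gamma_density c x = (if x \<le> 0 then 0 else x powr (c - 1) * exp (- x) / Gamma c)"

text \<open>Measurability is part of the definition because \<^const>\<open>distr\<close> carries no information
  for a non-measurable function.\<close>

definition eq_in_distr ::
  "'a measure \<Rightarrow> ('a \<Rightarrow> 'c) \<Rightarrow> 'b measure \<Rightarrow> ('b \<Rightarrow> 'c) \<Rightarrow> 'c measure \<Rightarrow> bool" where
  "eq_in_distr M X N Y S \<longleftrightarrow>
     X \<in> measurable M S \<and> Y \<in> measurable N S \<and> distr M S X = distr N S Y"

text \<open>The homogeneous Gamma process as a subordinator; only times \<open>t \<ge> 0\<close> matter.
  Path properties hold for every outcome, so that each path induces a measure.\<close>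

locale gamma_process = prob_space M
  for M :: "'a measure" and \<theta> :: real and G :: "real \<Rightarrow> 'a \<Rightarrow> real" +
  assumes rate_pos: "0 < \<theta>"
    and rv: "\<And>t. 0 \<le> t \<Longrightarrow> random_variable borel (G t)"
    and start_zero: "\<And>\<omega>. \<omega> \<in> space M \<Longrightarrow> G 0 \<omega> = 0"
    and paths_mono: "\<And>\<omega> s t. \<omega> \<in> space M \<Longrightarrow> 0 \<le> s \<Longrightarrow> s \<le> t \<Longrightarrow> G s \<omega> \<le> G t \<omega>"
    and paths_right_continuous:
      "\<And>\<omega> t. \<omega> \<in> space M \<Longrightarrow> 0 \<le> t \<Longrightarrow> continuous (at_right t) (\<lambda>s. G s \<omega>)"
    and indep_increments:
      "\<And>(t :: nat \<Rightarrow> real) n. 0 \<le> t 0 \<Longrightarrow> (\<And>i. i < n \<Longrightarrow> t i \<le> t (Suc i)) \<Longrightarrow>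
         indep_vars (\<lambda>_. borel) (\<lambda>i \<omega>. G (t (Suc i)) \<omega> - G (t i) \<omega>) {..<n}"
    and stationary_increments:
      "\<And>s t. 0 \<le> s \<Longrightarrow> s \<le> t \<Longrightarrow>
         distr M borel (\<lambda>\<omega>. G t \<omega> - G s \<omega>) = distr M borel (G (t - s))"
    and laplace:
      "\<And>t w. 0 \<le> t \<Longrightarrow> 0 \<le> w \<Longrightarrow>
         expectation (\<lambda>\<omega>. exp (- w * G t \<omega>)) = (1 + w) powr (- \<theta> * t)"

text \<open>The random measure of the process: \<open>{0<..t}\<close> has mass \<open>G t \<omega>\<close>, and \<open>{..0}\<close> is null.\<close>

definition process_measure :: "(real \<Rightarrow> 'a \<Rightarrow> real) \<Rightarrow> 'a \<Rightarrow> real measure" where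
  "process_measure G \<omega> = interval_measure (\<lambda>s. G (max 0 s) \<omega>)"

text \<open>The integral of \<open>g(y)\<close> against \<open>G(d\<lambda>y)\<close> over \<open>[0, t]\<close>.\<close>

definition scaled_integral ::
  "(real \<Rightarrow> 'a \<Rightarrow> real) \<Rightarrow> real \<Rightarrow> real \<Rightarrow> (real \<Rightarrow> real) \<Rightarrow> 'a \<Rightarrow> real" where
  "scaled_integral G l t g \<omega> = (LINT s:{0..l * t}|process_measure G \<omega>. g (s / l))"

definition log_uniform :: "real \<Rightarrow> real measure" where
  "log_uniform a = density lborel (\<lambda>y. ennreal (indicator {exp (- a)..1} y / (a * y)))"

text \<open>Gamma random measure with finite shape measure \<open>\<alpha>\<close>. The Gamma law of shape \<open>0\<close> is the
  point mass at \<open>0\<close>.\<close>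

locale gamma_random_measure = prob_space N + finite_measure \<alpha>
  for N :: "'a measure" and \<alpha> :: "'b measure" and \<kappa> :: "'a \<Rightarrow> 'b measure" +
  assumes sets_eq: "\<And>\<nu>. \<nu> \<in> space N \<Longrightarrow> sets (\<kappa> \<nu>) = sets \<alpha>"
    and finite_mass: "\<And>\<nu>. \<nu> \<in> space N \<Longrightarrow> finite_measure (\<kappa> \<nu>)"
    and rv: "\<And>A. A \<in> sets \<alpha> \<Longrightarrow> random_variable borel (\<lambda>\<nu>. measure (\<kappa> \<nu>) A)"
    and gamma_mass: "\<And>A. A \<in> sets \<alpha> \<Longrightarrow> 0 < measure \<alpha> A \<Longrightarrow>
       distributed N lborel (\<lambda>\<nu>. measure (\<kappa> \<nu>) A) (gamma_density (measure \<alpha> A))"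
    and null_mass: "\<And>A. A \<in> sets \<alpha> \<Longrightarrow> measure \<alpha> A = 0 \<Longrightarrow>
       AE \<nu> in N. measure (\<kappa> \<nu>) A = 0"
    and indep_masses: "\<And>(A :: nat \<Rightarrow> 'b set) n.
       (\<And>i. i < n \<Longrightarrow> A i \<in> sets \<alpha>) \<Longrightarrow> disjoint_family_on A {..<n} \<Longrightarrow>
       indep_vars (\<lambda>_. borel) (\<lambda>i \<nu>. measure (\<kappa> \<nu>) (A i)) {..<n}"

text \<open>Applied to a Gamma random measure with shape measure \<open>cH\<close>, normalization yields the
  Dirichlet process with shape \<open>cH\<close>.\<close>

definition normalize_measure :: "'b measure \<Rightarrow> 'b measure" where
  "normalize_measure \<mu> = scale_measure (1 / emeasure \<mu> (space \<mu>)) \<mu>"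

definition dirichlet_mean :: "('a \<Rightarrow> real measure) \<Rightarrow> 'a \<Rightarrow> real" where
  "dirichlet_mean \<kappa> \<nu> = (LINT x:{0..1}|normalize_measure (\<kappa> \<nu>). x)"

end

theory Submission
  imports Defs
begin

text \<open>
  Put \<open>c = \<theta> * a\<close>, let \<open>S\<close> be the total mass of the Gamma random measure \<open>\<kappa>\<close> and \<open>I\<close> the integral of
  the identity with respect to \<open>\<kappa>\<close>, so that \<open>I = S * M\<close> almost surely.

  The map \<open>s \<mapsto> exp (s - a)\<close> sends the uniform law on \<open>[0, a]\<close> to the log-uniform law on
  \<open>[exp (- a), 1]\<close>. Equidistant times in \<open>[0, a]\<close> therefore correspond to a geometric grid
  \<open>x\<^sub>0 < \<dots> < x\<^sub>n = 1\<close>, and the increments of the process as well as the masses that \<open>\<kappa>\<close> gives to the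
  grid cells are \<open>n\<close> independent Gamma variables of shape \<open>c / n\<close>. Both \<open>Y\<close> and \<open>I\<close> agree, up to a
  factor between \<open>1\<close> and \<open>exp (a / n)\<close>, with the sum of these variables weighted by the \<open>x\<^sub>i\<close>. Hence
  the joint Laplace transforms of \<open>(G a, Y)\<close> and of \<open>(S, I)\<close> at \<open>(w, z)\<close> are limits of the same products
  \<open>\<Prod>i<n. (1 + w + z * x\<^sub>i) powr (- c / n)\<close> (lemmas \<open>process_laplace\<close> and \<open>total_mean_laplace\<close>).
  Joint Laplace transforms determine laws on the quadrant (\<open>joint_distr_eqI_laplace\<close>), by
  reduction to the moment problem on the unit square, so the two pairs have the same law.

  To pass from \<open>(S, S * M)\<close> to \<open>(T, T * M)\<close> one needs that \<open>S\<close> and \<open>M\<close> are independent. This can be read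
  off from the same products: if \<open>L\<close> denotes their limit, then
  \<open>L (v + w) z = (1 + v) powr (- c) * L (w / (1 + v)) (z / (1 + v))\<close>. In words, weighting with
  \<open>exp (- v * S)\<close> amounts to dividing \<open>S\<close> and \<open>I\<close> by \<open>1 + v\<close>, which leaves the ratio \<open>M = I / S\<close>
  untouched (\<open>scale_tilting_ratio_laplace\<close>).

  The bounds on \<open>M\<close> are those of the identity on \<open>[exp (- a), 1]\<close>, and the other equalities in
  distribution are images of the joint one under measurable maps.
\<close>

section \<open>Laws on the quadrant are determined by their Laplace transforms\<close>

text \<open>Closed sets generate the Borel sets and are stable under intersection, and the indicator of a
  closed set is the decreasing limit of the continuous functions \<open>max 0 (1 - n * infdist x C)\<close>.\<close>

lemma finite_borel_measure_eqI_bounded_continuous: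
  fixes \<mu> \<nu> :: "'a :: metric_space measure"
  assumes fin: "finite_measure \<mu>" "finite_measure \<nu>"
    and sets: "sets \<mu> = sets borel" "sets \<nu> = sets borel"
    and eq: "\<And>f :: 'a \<Rightarrow> real. continuous_on UNIV f \<Longrightarrow> (\<And>x. \<bar>f x\<bar> \<le> 1) \<Longrightarrow>
               (\<integral>x. f x \<partial>\<mu>) = (\<integral>x. f x \<partial>\<nu>)"
  shows "\<mu> = \<nu>"
proof -
  \<comment> \<open>\<^const>\<open>infdist\<close> to the empty set is \<open>0\<close>, so that set is treated apart.\<close>
  define h where "h C n x = (if C = {} then 0 else max 0 (1 - real n * infdist x C))"
    for C :: "'a set" and n x
  have cont: "continuous_on UNIV (h C n)" for C n
    unfolding h_def by (cases "C = {}") (auto intro!: continuous_intros)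
  have bound: "\<bar>h C n x\<bar> \<le> 1" for C n x
    unfolding h_def using infdist_nonneg[of x C] by (auto simp: max_def)
  have lim: "(\<lambda>n. h C n x) \<longlonglongrightarrow> indicat_real C x" if "closed C" for C x
  proof (cases "x \<in> C")
    case True
    then show ?thesis by (cases "C = {}") (simp_all add: h_def)
  next
    case False
    show ?thesis
    proof (cases "C = {}")
      case ne: False
      have pos: "infdist x C > 0"
        using infdist_pos_not_in_closed[OF that ne False] .
      obtain m :: nat where m: "1 < real m * infdist x C"
        using reals_Archimedean3[OF pos] by blast
      have "h C n x = 0" if "n \<ge> m" for n
      proof -
        have "real m * infdist x C \<le> real n * infdist x C"
          using that pos by (intro mult_right_mono) auto
        then show ?thesis using m by (simp add: h_def)
      qed
      then have "eventually (\<lambda>n. h C n x = 0) sequentially"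
        by (auto simp: eventually_sequentially)
      then show ?thesis using False by (simp add: tendsto_eventually)
    qed (auto simp: h_def)
  qed
  have approx: "(\<lambda>n. \<integral>x. h C n x \<partial>\<rho>) \<longlonglongrightarrow> measure \<rho> C"
    if "closed C" and r: "finite_measure \<rho>" "sets \<rho> = sets borel" for C and \<rho> :: "'a measure"
  proof -
    interpret finite_measure \<rho> by fact
    have C: "C \<in> sets \<rho>" using that by auto
    have hm: "h C n \<in> borel_measurable \<rho>" for n
      using borel_measurable_continuous_onI[OF cont] measurable_cong_sets[OF r(2) refl] by blast
    have "(\<lambda>n. \<integral>x. h C n x \<partial>\<rho>) \<longlonglongrightarrow> (\<integral>x. indicat_real C x \<partial>\<rho>)"
      by (rule integral_dominated_convergence[where w="\<lambda>_. 1"])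
         (use C hm lim[OF \<open>closed C\<close>] bound in auto)
    also have "(\<integral>x. indicat_real C x \<partial>\<rho>) = measure \<rho> C"
      using C by simp
    finally show ?thesis .
  qed
  have closed_eq: "emeasure \<mu> C = emeasure \<nu> C" if "closed C" for C
  proof -
    have "measure \<mu> C = measure \<nu> C"
      using LIMSEQ_unique[OF approx[OF that fin(1) sets(1)]]
        approx[OF that fin(2) sets(2)] eq[OF cont bound] by simp
    then show ?thesis
      using fin by (simp add: finite_measure.emeasure_eq_measure)
  qed
  have gen: "sets borel = sigma_sets UNIV (Collect closed :: 'a set set)"
    by (simp add: borel_eq_closed)
  show ?thesis
  proof (rule measure_eqI_generator_eq[where E="Collect closed" and \<Omega>=UNIV and A="\<lambda>_. UNIV"])
    show "Int_stable (Collect closed :: 'a set set)" by (auto simp: Int_stable_def)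
    show "emeasure \<mu> UNIV \<noteq> \<infinity>" for i :: nat
      using fin(1) finite_measure.emeasure_finite by auto
  qed (use closed_eq gen sets in auto)
qed

lemma continuous_integrable_unit_square:
  fixes \<mu> :: "(real \<times> real) measure"
  assumes "finite_measure \<mu>" "sets \<mu> = sets borel"
    and AE: "AE p in \<mu>. p \<in> {0..1} \<times> {0..1}"
    and f: "continuous_on UNIV f"
  shows "integrable \<mu> (f :: _ \<Rightarrow> real)"
proof -
  interpret finite_measure \<mu> by fact
  have "compact (f ` ({0..1} \<times> {0..1}))"
    by (intro compact_continuous_image continuous_on_subset[OF f] compact_Times) auto
  then obtain B where B: "\<And>p. p \<in> {0..1} \<times> {0..1} \<Longrightarrow> \<bar>f p\<bar> \<le> B"
    using compact_imp_bounded bounded_iff by (metis image_eqI real_norm_def)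
  show ?thesis
  proof (rule integrable_const_bound[where B=B])
    show "AE p in \<mu>. norm (f p) \<le> B" using AE B by auto
    show "f \<in> borel_measurable \<mu>"
      using borel_measurable_continuous_onI[OF f] measurable_cong_sets[OF assms(2) refl] by blast
  qed
qed

text \<open>Equality of all mixed moments passes to integrals of polynomials. The class of polynomials is
  closed under products, which integrals do not respect; the extra weight \<open>h\<close> is what makes the
  induction go through, since the factor \<open>g\<close> of a product \<open>f * g\<close> can be moved into it.\<close>

lemma real_polynomial_moments_eq:
  fixes \<mu> \<nu> :: "(real \<times> real) measure"
  assumes \<mu>: "finite_measure \<mu>" "sets \<mu> = sets borel" "AE p in \<mu>. p \<in> {0..1} \<times> {0..1}"
    and \<nu>: "finite_measure \<nu>" "sets \<nu> = sets borel" "AE p in \<nu>. p \<in> {0..1} \<times> {0..1}"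
    and p: "real_polynomial_function p" and h: "continuous_on UNIV h"
    and eq: "\<And>m n. (\<integral>x. fst x ^ m * snd x ^ n * h x \<partial>\<mu>) = (\<integral>x. fst x ^ m * snd x ^ n * h x \<partial>\<nu>)"
  shows "(\<integral>x. fst x ^ m * snd x ^ n * (p x * h x) \<partial>\<mu>) = (\<integral>x. fst x ^ m * snd x ^ n * (p x * h x) \<partial>\<nu>)"
  using p h eq
proof (induction p arbitrary: h m n rule: real_polynomial_function.induct)
  case (linear f)
  note int = continuous_integrable_unit_square[OF \<mu>] continuous_integrable_unit_square[OF \<nu>]
  interpret f: bounded_linear f by fact
  have f: "f x = f (1,0) * fst x + f (0,1) * snd x" for x
  proof -
    have "x = fst x *\<^sub>R (1,0) + snd x *\<^sub>R (0,1)" by (cases x) auto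
    then have "f x = f (fst x *\<^sub>R (1,0) + snd x *\<^sub>R (0,1))" by simp
    also have "\<dots> = fst x * f (1,0) + snd x * f (0,1)"
      by (simp only: f.add f.scaleR real_scaleR_def)
    finally show ?thesis by (simp add: mult.commute)
  qed
  have *: "fst x ^ m * snd x ^ n * (f x * h x) =
     f (1,0) * (fst x ^ Suc m * snd x ^ n * h x) + f (0,1) * (fst x ^ m * snd x ^ Suc n * h x)" for x
    by (subst f) (simp add: algebra_simps)
  show ?case
    unfolding * using linear.prems(2)[of "Suc m" n] linear.prems(2)[of m "Suc n"]
    by (subst (1 2) Bochner_Integration.integral_add)
       (auto intro!: int continuous_intros linear.prems(1))
next
  case (const c)
  have "fst x ^ m * snd x ^ n * (c * h x) = c * (fst x ^ m * snd x ^ n * h x)" for x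
    by simp
  then show ?case by (simp only: integral_mult_right_zero const.prems(2))
next
  case (add f g)
  note int = continuous_integrable_unit_square[OF \<mu>] continuous_integrable_unit_square[OF \<nu>]
  have c: "continuous_on UNIV f" "continuous_on UNIV g"
    using add.hyps continuous_on_polymonial_function real_polynomial_function_eq by blast+
  have *: "fst x ^ m * snd x ^ n * ((f x + g x) * h x) =
     fst x ^ m * snd x ^ n * (f x * h x) + fst x ^ m * snd x ^ n * (g x * h x)" for x
    by (simp add: algebra_simps)
  show ?case
    unfolding * using add.IH(1)[OF add.prems] add.IH(2)[OF add.prems]
    by (subst (1 2) Bochner_Integration.integral_add)
       (auto intro!: int continuous_intros add.prems(1) c)
next
  case (mult f g)
  have c: "continuous_on UNIV g"
    using mult.hyps continuous_on_polymonial_function real_polynomial_function_eq by blast+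
  have "(\<integral>x. fst x ^ m * snd x ^ n * (f x * (g x * h x)) \<partial>\<mu>) =
        (\<integral>x. fst x ^ m * snd x ^ n * (f x * (g x * h x)) \<partial>\<nu>)"
    by (rule mult.IH(1)) (auto intro!: continuous_intros c mult.prems(1) mult.IH(2)[OF mult.prems])
  then show ?case by (simp add: mult.assoc)
qed

text \<open>By the Stone--Weierstrass theorem polynomials approximate continuous functions uniformly on the
  square, which carries both measures.\<close>

lemma unit_square_moment_problem_determinate:
  fixes \<mu> \<nu> :: "(real \<times> real) measure"
  assumes \<mu>: "prob_space \<mu>" "sets \<mu> = sets borel" "AE p in \<mu>. p \<in> {0..1} \<times> {0..1}"
    and \<nu>: "prob_space \<nu>" "sets \<nu> = sets borel" "AE p in \<nu>. p \<in> {0..1} \<times> {0..1}"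
    and eq: "\<And>m n. (\<integral>x. fst x ^ m * snd x ^ n \<partial>\<mu>) = (\<integral>x. fst x ^ m * snd x ^ n \<partial>\<nu>)"
  shows "\<mu> = \<nu>"
proof (rule finite_borel_measure_eqI_bounded_continuous)
  interpret \<mu>: prob_space \<mu> by fact
  interpret \<nu>: prob_space \<nu> by fact
  show fin: "finite_measure \<mu>" "finite_measure \<nu>" by unfold_locales
  show "sets \<mu> = sets borel" "sets \<nu> = sets borel" by fact+
  fix f :: "real \<times> real \<Rightarrow> real" assume f: "continuous_on UNIV f"
  have "\<bar>(\<integral>x. f x \<partial>\<mu>) - (\<integral>x. f x \<partial>\<nu>)\<bar> \<le> e" if "e > 0" for e
  proof -
    obtain p where p: "real_polynomial_function p"
      and close: "\<And>x. x \<in> {0..1} \<times> {0..1} \<Longrightarrow> \<bar>f x - p x\<bar> < e / 2"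
      using Stone_Weierstrass_real_polynomial_function[of "{0..1} \<times> {0..1}" f "e / 2"] \<open>e > 0\<close>
        continuous_on_subset[OF f] by (metis compact_Icc compact_Times half_gt_zero subset_UNIV)
    have cp: "continuous_on UNIV p"
      using p continuous_on_polymonial_function real_polynomial_function_eq by blast
    have near: "\<bar>(\<integral>x. f x \<partial>\<rho>) - (\<integral>x. p x \<partial>\<rho>)\<bar> \<le> e / 2"
      if r: "prob_space \<rho>" "sets \<rho> = sets borel" "AE p in \<rho>. p \<in> {0..1} \<times> {0..1}" for \<rho>
    proof -
      interpret prob_space \<rho> by fact
      have i: "integrable \<rho> f" "integrable \<rho> p"
        using r f cp finite_measure_axioms by (auto intro: continuous_integrable_unit_square)
      have "\<bar>\<integral>x. f x - p x \<partial>\<rho>\<bar> \<le> (\<integral>x. \<bar>f x - p x\<bar> \<partial>\<rho>)"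
        by (rule integral_abs_bound)
      also have "\<dots> \<le> (\<integral>x. e / 2 \<partial>\<rho>)"
      proof (rule integral_mono_AE)
        show "AE x in \<rho>. \<bar>f x - p x\<bar> \<le> e / 2"
          using r(3) by eventually_elim (rule less_imp_le[OF close])
      qed (use i in auto)
      also have "\<dots> = e / 2" by (simp add: prob_space)
      finally show ?thesis using i by simp
    qed
    have "(\<integral>x. p x \<partial>\<mu>) = (\<integral>x. p x \<partial>\<nu>)"
      using real_polynomial_moments_eq[OF fin(1) \<mu>(2,3) fin(2) \<nu>(2,3) p, of "\<lambda>_. 1" 0 0] eq
      by simp
    then show ?thesis using near[OF \<mu>] near[OF \<nu>] by linarith
  qed
  then have "\<bar>(\<integral>x. f x \<partial>\<mu>) - (\<integral>x. f x \<partial>\<nu>)\<bar> \<le> 0"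
    by (rule field_le_epsilon) simp
  then show "(\<integral>x. f x \<partial>\<mu>) = (\<integral>x. f x \<partial>\<nu>)" by simp
qed

text \<open>The substitution \<open>(x, y) \<mapsto> (exp (- x), exp (- y))\<close> maps the quadrant injectively into the unit
  square and turns the Laplace transform at natural arguments into mixed moments.\<close>

lemma joint_distr_eqI_laplace:
  fixes X Y :: "'a \<Rightarrow> real" and U V :: "'b \<Rightarrow> real"
  assumes P: "prob_space P" and Q: "prob_space Q"
    and [measurable]: "X \<in> borel_measurable P" "Y \<in> borel_measurable P"
      "U \<in> borel_measurable Q" "V \<in> borel_measurable Q"
    and nonneg: "AE \<omega> in P. 0 \<le> X \<omega> \<and> 0 \<le> Y \<omega>" "AE \<omega> in Q. 0 \<le> U \<omega> \<and> 0 \<le> V \<omega>"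
    and eq: "\<And>m n :: nat. (\<integral>\<omega>. exp (- (real m * X \<omega> + real n * Y \<omega>)) \<partial>P) =
                           (\<integral>\<omega>. exp (- (real m * U \<omega> + real n * V \<omega>)) \<partial>Q)"
  shows "distr P (borel \<Otimes>\<^sub>M borel) (\<lambda>\<omega>. (X \<omega>, Y \<omega>)) = distr Q (borel \<Otimes>\<^sub>M borel) (\<lambda>\<omega>. (U \<omega>, V \<omega>))"
proof -
  interpret P: prob_space P by fact
  interpret Q: prob_space Q by fact
  let ?e = "\<lambda>(x, y). (exp (- x), exp (- y)) :: real \<times> real"
  let ?l = "\<lambda>(u, v). (- ln u, - ln v) :: real \<times> real"
  define \<mu> where "\<mu> = distr P borel (\<lambda>\<omega>. (exp (- X \<omega>), exp (- Y \<omega>)))"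
  define \<nu> where "\<nu> = distr Q borel (\<lambda>\<omega>. (exp (- U \<omega>), exp (- V \<omega>)))"
  have mP[measurable]: "(\<lambda>\<omega>. (exp (- X \<omega>), exp (- Y \<omega>))) \<in> measurable P borel"
    by (subst borel_prod[symmetric]) measurable
  have mQ[measurable]: "(\<lambda>\<omega>. (exp (- U \<omega>), exp (- V \<omega>))) \<in> measurable Q borel"
    by (subst borel_prod[symmetric]) measurable
  have exp_moment: "exp (- x) ^ m * exp (- y) ^ n = exp (- (real m * x + real n * y))"
    for x y :: real and m n
    by (simp add: exp_of_nat_mult[symmetric] exp_add[symmetric] algebra_simps)
  have mom: "(\<lambda>x. fst x ^ m * snd x ^ n :: real) \<in> borel_measurable borel" for m n
    by (intro borel_measurable_continuous_onI continuous_intros)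
  have eq': "\<mu> = \<nu>"
  proof (rule unit_square_moment_problem_determinate)
    show "prob_space \<mu>" "prob_space \<nu>"
      unfolding \<mu>_def \<nu>_def by (auto intro!: P.prob_space_distr Q.prob_space_distr mP mQ)
    show "AE p in \<mu>. p \<in> {0..1} \<times> {0..1}"
      unfolding \<mu>_def using nonneg(1) by (subst AE_distr_iff) (auto intro!: closed_Times borel_closed)
    show "AE p in \<nu>. p \<in> {0..1} \<times> {0..1}"
      unfolding \<nu>_def using nonneg(2) by (subst AE_distr_iff) (auto intro!: closed_Times borel_closed)
    show "(\<integral>x. fst x ^ m * snd x ^ n \<partial>\<mu>) = (\<integral>x. fst x ^ m * snd x ^ n \<partial>\<nu>)" for m n
      unfolding \<mu>_def \<nu>_def using eq[of m n]
      by (simp add: integral_distr[OF mP mom] integral_distr[OF mQ mom] exp_moment)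
  qed (simp_all add: \<mu>_def \<nu>_def)
  have ml: "?l \<in> measurable borel (borel \<Otimes>\<^sub>M borel)"
    by (subst borel_prod[symmetric]) measurable
  have "distr P (borel \<Otimes>\<^sub>M borel) (\<lambda>\<omega>. (X \<omega>, Y \<omega>)) = distr \<mu> (borel \<Otimes>\<^sub>M borel) ?l"
    unfolding \<mu>_def by (subst distr_distr[OF ml mP]) (simp add: comp_def)
  also have "\<dots> = distr Q (borel \<Otimes>\<^sub>M borel) (\<lambda>\<omega>. (U \<omega>, V \<omega>))"
    unfolding eq' \<nu>_def by (subst distr_distr[OF ml mQ]) (simp add: comp_def)
  finally show ?thesis .
qed

section \<open>Gamma variables\<close>

lemma gamma_density_laplace:
  assumes c: "0 < c" and w: "0 \<le> w"
  shows "(\<integral>x. gamma_density c x * exp (- w * x) \<partial>lborel) = (1 + w) powr (- c)"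
proof -
  have [measurable]: "gamma_density c \<in> borel_measurable borel"
    unfolding gamma_density_def by measurable
  have nonneg: "0 \<le> gamma_density c x" for x
    using Gamma_real_pos[OF c] by (auto simp: gamma_density_def)
  have "((\<lambda>t. t powr (c - 1) / exp t / Gamma c) has_integral Gamma c / Gamma c) {0..}"
    using Gamma_integral_real[OF c] by (rule has_integral_divide)
  then have "(gamma_density c has_integral 1) {0..}"
    using Gamma_real_pos[OF c]
    by (subst has_integral_spike_eq[where S="{0}"])
       (auto simp: gamma_density_def exp_minus field_simps)
  then have "(gamma_density c has_integral 1) UNIV"
    by (rule has_integral_on_superset) (auto simp: gamma_density_def)
  then have "(\<integral>\<^sup>+x. gamma_density c x \<partial>lborel) = 1"
    using nonneg by (subst nn_integral_has_integral_lborel) auto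
  then have total: "(\<integral>x. gamma_density c x \<partial>lborel) = 1"
    using nonneg by (subst integral_eq_nn_integral) auto
  \<comment> \<open>Up to a constant, tilting by \<open>exp (- w * x)\<close> only rescales the argument by \<open>1 + w\<close>.\<close>
  have "gamma_density c x * exp (- w * x) =
        (1 + w) powr (1 - c) * gamma_density c (0 + (1 + w) * x)" for x
  proof (cases "x \<le> 0")
    case True
    then show ?thesis using w by (auto simp: gamma_density_def mult_le_0_iff)
  next
    case False
    then have x: "0 < x" by simp
    then have "0 < (1 + w) * x" using w by simp
    have p: "(1 + w) powr (1 - c) * ((1 + w) * x) powr (c - 1) = x powr (c - 1)"
      using w x by (simp add: powr_mult mult.assoc[symmetric] powr_add[symmetric])
    have e: "exp (- x) * exp (- w * x) = exp (- ((1 + w) * x))"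
      by (simp add: exp_add[symmetric] algebra_simps)
    have "gamma_density c x * exp (- w * x) =
          x powr (c - 1) * (exp (- x) * exp (- w * x)) / Gamma c"
      using x by (simp add: gamma_density_def)
    also have "\<dots> = (1 + w) powr (1 - c) * ((1 + w) * x) powr (c - 1) * exp (- ((1 + w) * x)) / Gamma c"
      by (simp only: p e)
    finally show ?thesis
      using \<open>0 < (1 + w) * x\<close> by (simp add: gamma_density_def)
  qed
  then have "(\<integral>x. gamma_density c x * exp (- w * x) \<partial>lborel) =
      (1 + w) powr (1 - c) * (\<integral>x. gamma_density c (0 + (1 + w) * x) \<partial>lborel)"
    by simp
  also have "(\<integral>x. gamma_density c (0 + (1 + w) * x) \<partial>lborel) = 1 / (1 + w)"
    using lborel_integral_real_affine[of "1 + w" "gamma_density c" 0] total w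
    by (simp add: field_simps)
  also have "(1 + w) powr (1 - c) * (1 / (1 + w)) = (1 + w) powr (- c)"
    using w by (simp add: powr_diff powr_minus field_simps)
  finally show ?thesis .
qed

lemma (in prob_space) gamma_variable_laplace:
  assumes X: "distributed M lborel X (gamma_density c)" and "0 < c" "0 \<le> w"
  shows "expectation (\<lambda>\<omega>. exp (- w * X \<omega>)) = (1 + w) powr (- c)"
proof -
  have nonneg: "0 \<le> gamma_density c x" for x
    using Gamma_real_pos[OF \<open>0 < c\<close>] by (auto simp: gamma_density_def)
  show ?thesis
    using distributed_integral[OF X, of "\<lambda>x. exp (- w * x)"] nonneg
      gamma_density_laplace[OF assms(2,3)] by simp
qed

lemma (in prob_space) gamma_variable_pos:
  assumes X: "distributed M lborel X (gamma_density c)"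
  shows "AE \<omega> in M. 0 < X \<omega>"
  by (subst distributed_AE2[OF X]) (auto simp: gamma_density_def)

section \<open>Step approximations of integrals\<close>

lemma set_integrable_bounded:
  fixes g :: "'a \<Rightarrow> real"
  assumes A: "A \<in> sets \<mu>" "emeasure \<mu> A \<noteq> \<infinity>" and [measurable]: "g \<in> borel_measurable \<mu>"
    and b: "\<And>s. s \<in> A \<Longrightarrow> \<bar>g s\<bar> \<le> b"
  shows "set_integrable \<mu> A g"
proof (rule set_integrable_bound)
  show "set_integrable \<mu> A (\<lambda>_. b)"
    using A unfolding set_integrable_def by (intro integrable_scaleR_left) (auto simp: less_top)
  show "set_borel_measurable \<mu> A g"
    using A(1) unfolding set_borel_measurable_def by measurable
  show "AE s in \<mu>. s \<in> A \<longrightarrow> norm (g s) \<le> norm b"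
  proof (intro AE_I2 impI)
    fix s assume "s \<in> A"
    then show "norm (g s) \<le> norm b" using b[of s] by simp
  qed
qed

lemma set_integral_step_bounds:
  fixes g :: "'a \<Rightarrow> real" and A :: "nat \<Rightarrow> 'a set"
  assumes A: "\<And>i. i < n \<Longrightarrow> A i \<in> sets \<mu>" "\<And>i. i < n \<Longrightarrow> emeasure \<mu> (A i) \<noteq> \<infinity>"
      "disjoint_family_on A {..<n}"
    and B: "B \<in> sets \<mu>" "AE s in \<mu>. s \<in> B \<longleftrightarrow> s \<in> (\<Union>i<n. A i)"
    and g[measurable]: "g \<in> borel_measurable \<mu>"
    and bounds: "\<And>i s. i < n \<Longrightarrow> s \<in> A i \<Longrightarrow> x i \<le> g s \<and> g s \<le> y i"
  shows "(\<Sum>i<n. x i * measure \<mu> (A i)) \<le> (LINT s:B|\<mu>. g s)"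
    and "(LINT s:B|\<mu>. g s) \<le> (\<Sum>i<n. y i * measure \<mu> (A i))"
proof -
  have const: "set_integrable \<mu> (A i) (\<lambda>_. r)" if "i < n" for i and r :: real
    by (rule set_integrable_bounded[OF A(1,2)[OF that], where b="\<bar>r\<bar>"]) auto
  have int: "set_integrable \<mu> (A i) g" if "i < n" for i
    by (rule set_integrable_bounded[OF A(1,2)[OF that] g, where b="\<bar>x i\<bar> + \<bar>y i\<bar>"])
       (use bounds[OF that] in fastforce)
  have U: "(\<Union>i<n. A i) \<in> sets \<mu>" using A(1) by auto
  have "(LINT s:B|\<mu>. g s) = (LINT s:(\<Union>i<n. A i)|\<mu>. g s)"
    using B U unfolding set_borel_measurable_def
    by (intro set_integral_cong_set) (auto simp: set_borel_measurable_def)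
  also have "\<dots> = (\<Sum>i<n. LINT s:A i|\<mu>. g s)"
    using A int by (intro set_integral_finite_Union) auto
  finally have eq: "(LINT s:B|\<mu>. g s) = (\<Sum>i<n. LINT s:A i|\<mu>. g s)" .
  have lo: "x i * measure \<mu> (A i) \<le> (LINT s:A i|\<mu>. g s)"
    and hi: "(LINT s:A i|\<mu>. g s) \<le> y i * measure \<mu> (A i)" if "i < n" for i
  proof -
    have c: "(LINT s:A i|\<mu>. r) = r * measure \<mu> (A i)" for r :: real
      using A(1,2)[OF that] by (simp add: set_integral_const)
    show "x i * measure \<mu> (A i) \<le> (LINT s:A i|\<mu>. g s)"
      unfolding c[symmetric] using bounds[OF that] by (intro set_integral_mono const int that) auto
    show "(LINT s:A i|\<mu>. g s) \<le> y i * measure \<mu> (A i)"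
      unfolding c[symmetric] using bounds[OF that] by (intro set_integral_mono const int that) auto
  qed
  show "(\<Sum>i<n. x i * measure \<mu> (A i)) \<le> (LINT s:B|\<mu>. g s)"
    "(LINT s:B|\<mu>. g s) \<le> (\<Sum>i<n. y i * measure \<mu> (A i))"
    unfolding eq using lo hi by (auto intro!: sum_mono)
qed

lemma disjoint_family_Ioc:
  fixes u :: "nat \<Rightarrow> real"
  assumes "mono u"
  shows "disjoint_family_on (\<lambda>i. {u i<..u (Suc i)}) I"
proof -
  have "{u i<..u (Suc i)} \<inter> {u j<..u (Suc j)} = {}" if "i < j" for i j
    using monoD[OF assms, of "Suc i" j] that by auto
  then show ?thesis
    unfolding disjoint_family_on_def by (metis inf_commute nat_neq_iff)
qed

lemma UN_Ioc:
  fixes u :: "nat \<Rightarrow> real"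
  assumes "mono u"
  shows "(\<Union>i<n. {u i<..u (Suc i)}) = {u 0<..u n}"
proof (induction n)
  case (Suc n)
  have "{u 0<..u n} \<union> {u n<..u (Suc n)} = {u 0<..u (Suc n)}"
    using monoD[OF assms, of 0 n] monoD[OF assms, of n "Suc n"] by auto
  then show ?case
    using Suc by (simp add: lessThan_Suc Un_commute)
qed simp

lemma tendsto_of_relative_bounds:
  fixes J q :: "nat \<Rightarrow> real"
  assumes "\<And>n. J n \<le> L" "\<And>n. L \<le> q n * J n" and q: "q \<longlonglongrightarrow> 1" "\<And>n. 0 < q n"
  shows "J \<longlonglongrightarrow> L"
proof (rule tendsto_sandwich)
  show "eventually (\<lambda>n. L / q n \<le> J n) sequentially"
    using assms(2) q(2) by (auto simp: divide_le_eq mult.commute)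
  show "eventually (\<lambda>n. J n \<le> L) sequentially" using assms(1) by auto
  show "(\<lambda>n. L / q n) \<longlonglongrightarrow> L"
    using tendsto_divide[OF tendsto_const q(1), of L] by simp
qed simp

text \<open>The joint Laplace transform of a total \<open>S\<close> and an integral \<open>I\<close> with respect to a random measure
  is determined by the Gamma masses \<open>D n i\<close> of the cells of finer and finer partitions, because \<open>I\<close>
  is squeezed between multiples of the step sums \<open>\<Sum>i. x n i * D n i\<close>. For a step sum, independence
  factorizes the transform, and each factor is that of a Gamma variable of shape \<open>c / Suc n\<close>.\<close>

lemma (in prob_space) laplace_limit_of_step_approximation:
  fixes D :: "nat \<Rightarrow> nat \<Rightarrow> 'a \<Rightarrow> real" and x :: "nat \<Rightarrow> nat \<Rightarrow> real"
  assumes indep: "\<And>n. indep_vars (\<lambda>_. borel) (D n) {..<Suc n}"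
    and laplace: "\<And>n i t. i < Suc n \<Longrightarrow> 0 \<le> t \<Longrightarrow>
        expectation (\<lambda>\<omega>. exp (- t * D n i \<omega>)) = (1 + t) powr (- (c / real (Suc n)))"
    and D_nonneg: "\<And>n i. i < Suc n \<Longrightarrow> AE \<omega> in M. 0 \<le> D n i \<omega>"
    and x_nonneg: "\<And>n i. 0 \<le> x n i"
    and S: "\<And>n. AE \<omega> in M. S \<omega> = (\<Sum>i<Suc n. D n i \<omega>)"
    and I: "\<And>n. AE \<omega> in M. (\<Sum>i<Suc n. x n i * D n i \<omega>) \<le> I \<omega> \<and>
                           I \<omega> \<le> q n * (\<Sum>i<Suc n. x n i * D n i \<omega>)"
    and q: "q \<longlonglongrightarrow> 1" "\<And>n. 0 < q n"
    and [measurable]: "S \<in> borel_measurable M" "I \<in> borel_measurable M"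
    and w: "0 \<le> w" and z: "0 \<le> z"
  shows "(\<lambda>n. \<Prod>i<Suc n. (1 + w + z * x n i) powr (- (c / real (Suc n))))
           \<longlonglongrightarrow> expectation (\<lambda>\<omega>. exp (- (w * S \<omega> + z * I \<omega>)))"
proof -
  have [measurable]: "i < Suc n \<Longrightarrow> D n i \<in> borel_measurable M" for n i
    using indep[of n] by (auto simp: indep_vars_def)
  define J where "J n \<omega> = (\<Sum>i<Suc n. x n i * D n i \<omega>)" for n \<omega>
  have [measurable]: "J n \<in> borel_measurable M" for n
    unfolding J_def by (intro borel_measurable_sum borel_measurable_times) auto
  have J_nonneg: "AE \<omega> in M. \<forall>n. 0 \<le> J n \<omega>"
  proof (subst AE_all_countable, intro allI)
    fix n
    have "AE \<omega> in M. \<forall>i\<in>{..<Suc n}. 0 \<le> D n i \<omega>"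
      using D_nonneg by (intro AE_finite_allI) auto
    then show "AE \<omega> in M. 0 \<le> J n \<omega>"
      unfolding J_def by eventually_elim (auto intro!: sum_nonneg mult_nonneg_nonneg simp: x_nonneg simp del: sum.lessThan_Suc)
  qed
  have S_nonneg: "AE \<omega> in M. 0 \<le> S \<omega>"
  proof -
    have "AE \<omega> in M. \<forall>i\<in>{..<Suc 0}. 0 \<le> D 0 i \<omega>"
      using D_nonneg by (intro AE_finite_allI) auto
    then show ?thesis using S[of 0] by eventually_elim simp
  qed
  have I': "AE \<omega> in M. \<forall>n. J n \<omega> \<le> I \<omega> \<and> I \<omega> \<le> q n * J n \<omega>"
    using I unfolding J_def by (subst AE_all_countable) auto
  have lim: "AE \<omega> in M. (\<lambda>n. J n \<omega>) \<longlonglongrightarrow> I \<omega>"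
    using I'
  proof eventually_elim
    case (elim \<omega>)
    show ?case
      by (rule tendsto_of_relative_bounds[OF _ _ q]) (use elim in auto)
  qed
  have step: "expectation (\<lambda>\<omega>. exp (- (w * S \<omega> + z * J n \<omega>))) =
      (\<Prod>i<Suc n. (1 + w + z * x n i) powr (- (c / real (Suc n))))" for n
  proof -
    define t where "t i = w + z * x n i" for i
    have t: "0 \<le> t i" for i using w z x_nonneg by (simp add: t_def)
    have "AE \<omega> in M. exp (- (w * S \<omega> + z * J n \<omega>)) = (\<Prod>i<Suc n. exp (- t i * D n i \<omega>))"
      using S[of n]
    proof eventually_elim
      case (elim \<omega>)
      have "- (w * S \<omega> + z * J n \<omega>) = (\<Sum>i<Suc n. - t i * D n i \<omega>)"
        unfolding elim J_def t_def sum_distrib_left sum.distrib[symmetric] sum_negf[symmetric]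
        by (intro sum.cong) (auto simp: algebra_simps)
      then show ?case by (simp only: exp_sum[OF finite_lessThan])
    qed
    then have "expectation (\<lambda>\<omega>. exp (- (w * S \<omega> + z * J n \<omega>))) =
        expectation (\<lambda>\<omega>. \<Prod>i<Suc n. exp (- t i * D n i \<omega>))"
      by (intro integral_cong_AE) (auto intro!: borel_measurable_prod)
    also have "\<dots> = (\<Prod>i<Suc n. expectation (\<lambda>\<omega>. exp (- t i * D n i \<omega>)))"
    proof (rule indep_vars_lebesgue_integral)
      show "indep_vars (\<lambda>_. borel) (\<lambda>i \<omega>. exp (- t i * D n i \<omega>)) {..<Suc n}"
        by (rule indep_vars_compose2[OF indep, where Y="\<lambda>i d. exp (- t i * d)"]) simp
      fix i assume "i \<in> {..<Suc n}"
      then have i: "i < Suc n" by simp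
      show "integrable M (\<lambda>\<omega>. exp (- t i * D n i \<omega>))"
      proof (rule integrable_const_bound[where B=1])
        show "AE \<omega> in M. norm (exp (- t i * D n i \<omega>)) \<le> 1"
          using D_nonneg[OF i] by eventually_elim (use t[of i] in auto)
      qed (use i in measurable)
    qed simp
    also have "\<dots> = (\<Prod>i<Suc n. (1 + w + z * x n i) powr (- (c / real (Suc n))))"
    proof (rule prod.cong[OF refl])
      fix i assume "i \<in> {..<Suc n}"
      then have "expectation (\<lambda>\<omega>. exp (- t i * D n i \<omega>)) = (1 + t i) powr (- (c / real (Suc n)))"
        by (intro laplace t) simp
      then show "expectation (\<lambda>\<omega>. exp (- t i * D n i \<omega>)) =
          (1 + w + z * x n i) powr (- (c / real (Suc n)))"
        by (simp only: t_def add.assoc)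
    qed
    finally show ?thesis .
  qed
  have "(\<lambda>n. expectation (\<lambda>\<omega>. exp (- (w * S \<omega> + z * J n \<omega>))))
          \<longlonglongrightarrow> expectation (\<lambda>\<omega>. exp (- (w * S \<omega> + z * I \<omega>)))"
  proof (rule integral_dominated_convergence[where w="\<lambda>_. 1"])
    show "AE \<omega> in M. (\<lambda>n. exp (- (w * S \<omega> + z * J n \<omega>))) \<longlonglongrightarrow> exp (- (w * S \<omega> + z * I \<omega>))"
      using lim by eventually_elim (auto intro!: tendsto_intros)
    show "AE \<omega> in M. norm (exp (- (w * S \<omega> + z * J n \<omega>))) \<le> 1" for n
      using J_nonneg S_nonneg
    proof eventually_elim
      case (elim \<omega>)
      have "0 \<le> w * S \<omega> + z * J n \<omega>"
        using w z elim by (intro add_nonneg_nonneg mult_nonneg_nonneg) auto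
      then show ?case by simp
    qed
  qed auto
  then show ?thesis by (simp only: step)
qed

section \<open>Independence of a sum and a ratio by exponential tilting\<close>

text \<open>The hypothesis \<open>tilt\<close> says that weighting the probability with \<open>(1 + v) powr c * exp (- v * S)\<close>
  changes the law of \<open>(S, I)\<close> in the same way as dividing both variables by \<open>1 + v\<close>. Division by a
  common factor does not change the ratio \<open>I / S\<close>, so the weighting does not change the law of
  \<open>I / S\<close> either. As all functions \<open>exp (- v * S)\<close> are weights of this kind, this expresses that
  \<open>S\<close> and \<open>I / S\<close> are independent.\<close>

lemma (in prob_space) scale_tilting_ratio_laplace:
  fixes S I :: "'a \<Rightarrow> real" and c v z :: real
  assumes [measurable]: "S \<in> borel_measurable M" "I \<in> borel_measurable M"
    and nonneg: "AE \<omega> in M. 0 \<le> S \<omega> \<and> 0 \<le> I \<omega>"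
    and tilt: "\<And>v w z. 0 \<le> v \<Longrightarrow> 0 \<le> w \<Longrightarrow> 0 \<le> z \<Longrightarrow>
      expectation (\<lambda>\<omega>. exp (- ((v + w) * S \<omega> + z * I \<omega>))) =
      (1 + v) powr (- c) * expectation (\<lambda>\<omega>. exp (- (w / (1 + v) * S \<omega> + z / (1 + v) * I \<omega>)))"
    and v: "0 \<le> v"
  shows "expectation (\<lambda>\<omega>. exp (- (v * S \<omega> + z * (I \<omega> / S \<omega>)))) =
         (1 + v) powr (- c) * expectation (\<lambda>\<omega>. exp (- (z * (I \<omega> / S \<omega>))))"
proof -
  define f where "f \<omega> = (1 + v) powr c * exp (- v * S \<omega>)" for \<omega>
  define Q where "Q = density M (\<lambda>\<omega>. ennreal (f \<omega>))"
  have f[measurable]: "f \<in> borel_measurable M" unfolding f_def by measurable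
  have f_nonneg: "0 \<le> f \<omega>" for \<omega> by (simp add: f_def)
  have Q: "(\<integral>\<omega>. g \<omega> \<partial>Q) = expectation (\<lambda>\<omega>. f \<omega> * g \<omega>)"
    if "g \<in> borel_measurable M" for g :: "'a \<Rightarrow> real"
    unfolding Q_def using that f_nonneg by (subst integral_density) auto
  have cancel: "(1 + v) powr c * (1 + v) powr (- c) = 1"
    using v by (simp add: powr_add[symmetric])
  have E0: "expectation (\<lambda>\<omega>. exp (- (v * S \<omega>))) = (1 + v) powr (- c)"
    using tilt[of v 0 0] v by (simp add: prob_space)
  have "integrable M f"
    unfolding f_def
  proof (intro integrable_mult_right integrable_const_bound[where B=1])
    show "AE \<omega> in M. norm (exp (- v * S \<omega>)) \<le> 1"
      using nonneg by eventually_elim (use v in auto)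
  qed auto
  then have "emeasure Q (space Q) = ennreal (expectation f)"
    unfolding Q_def using f_nonneg
    by (subst emeasure_density) (auto intro!: nn_integral_eq_integral)
  also have "expectation f = 1"
    unfolding f_def using E0 cancel by simp
  finally have probQ: "prob_space Q" by (intro prob_spaceI) simp
  have meas: "g \<in> borel_measurable M \<Longrightarrow> g \<in> borel_measurable Q" for g :: "'a \<Rightarrow> real"
    by (simp add: Q_def)
  have nonnegQ: "AE \<omega> in Q. 0 \<le> S \<omega> \<and> 0 \<le> I \<omega>"
    unfolding Q_def using nonneg by (subst AE_density) auto
  have law: "distr Q (borel \<Otimes>\<^sub>M borel) (\<lambda>\<omega>. (S \<omega>, I \<omega>)) =
             distr M (borel \<Otimes>\<^sub>M borel) (\<lambda>\<omega>. (S \<omega> / (1 + v), I \<omega> / (1 + v)))"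
  proof (rule joint_distr_eqI_laplace[OF probQ prob_space_axioms])
    show "AE \<omega> in M. 0 \<le> S \<omega> / (1 + v) \<and> 0 \<le> I \<omega> / (1 + v)"
      using nonneg by eventually_elim (use v in auto)
    fix m n :: nat
    have combine: "f \<omega> * exp (- (real m * S \<omega> + real n * I \<omega>)) =
        (1 + v) powr c * exp (- ((v + real m) * S \<omega> + real n * I \<omega>))" for \<omega>
      unfolding f_def mult.assoc exp_add[symmetric] by (simp add: algebra_simps)
    have "(\<integral>\<omega>. exp (- (real m * S \<omega> + real n * I \<omega>)) \<partial>Q) =
        (1 + v) powr c * expectation (\<lambda>\<omega>. exp (- ((v + real m) * S \<omega> + real n * I \<omega>)))"
      by (subst Q) (simp_all only: combine integral_mult_right_zero, measurable)
    also have "\<dots> = expectation (\<lambda>\<omega>. exp (- (real m * (S \<omega> / (1 + v)) + real n * (I \<omega> / (1 + v)))))"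
      using v cancel by (subst tilt) (auto simp: mult.assoc[symmetric])
    finally show "(\<integral>\<omega>. exp (- (real m * S \<omega> + real n * I \<omega>)) \<partial>Q) =
      expectation (\<lambda>\<omega>. exp (- (real m * (S \<omega> / (1 + v)) + real n * (I \<omega> / (1 + v)))))" .
  qed (use nonnegQ in \<open>auto intro!: meas\<close>)
  let ?h = "\<lambda>p :: real \<times> real. exp (- (z * (snd p / fst p)))"
  have h: "?h \<in> borel_measurable (borel \<Otimes>\<^sub>M borel)" by measurable
  have SI: "(\<lambda>\<omega>. (S \<omega>, I \<omega>)) \<in> measurable Q (borel \<Otimes>\<^sub>M borel)"
    by (intro measurable_Pair meas assms)
  have "(\<integral>\<omega>. exp (- (z * (I \<omega> / S \<omega>))) \<partial>Q) = (\<integral>p. ?h p \<partial>distr Q (borel \<Otimes>\<^sub>M borel) (\<lambda>\<omega>. (S \<omega>, I \<omega>)))"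
    by (subst integral_distr[OF SI h]) simp
  also have "\<dots> = expectation (\<lambda>\<omega>. exp (- (z * (I \<omega> / S \<omega>))))"
    unfolding law using v by (subst integral_distr[OF _ h]) auto
  finally have "expectation (\<lambda>\<omega>. f \<omega> * exp (- (z * (I \<omega> / S \<omega>)))) =
      expectation (\<lambda>\<omega>. exp (- (z * (I \<omega> / S \<omega>))))"
    by (subst (asm) Q) auto
  moreover have "f \<omega> * exp (- (z * (I \<omega> / S \<omega>))) =
      (1 + v) powr c * exp (- (v * S \<omega> + z * (I \<omega> / S \<omega>)))" for \<omega>
    unfolding f_def mult.assoc exp_add[symmetric] by (simp add: algebra_simps)
  ultimately have "(1 + v) powr c * expectation (\<lambda>\<omega>. exp (- (v * S \<omega> + z * (I \<omega> / S \<omega>)))) =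
      expectation (\<lambda>\<omega>. exp (- (z * (I \<omega> / S \<omega>))))"
    by simp
  then show ?thesis
    using v by (simp add: powr_minus field_simps)
qed

section \<open>The geometric grid and the log-uniform law\<close>

text \<open>Points of the interval \<open>[exp (- a), 1]\<close> with constant ratio \<open>exp (a / Suc n)\<close>. They are the
  images of the equidistant points of \<open>[0, a]\<close> under \<open>s \<mapsto> exp (s - a)\<close>, and each cell between
  neighbours has the same probability under the log-uniform law.\<close>

definition grid :: "real \<Rightarrow> nat \<Rightarrow> nat \<Rightarrow> real" where
  "grid a n i = exp (- a + a * real i / real (Suc n))"

text \<open>The Laplace transform of \<open>(\<Sum>i. D i, \<Sum>i. grid a n i * D i)\<close> when the \<open>D i\<close> are independent
  Gamma variables of shape \<open>c / Suc n\<close>.\<close>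

definition grid_laplace :: "real \<Rightarrow> real \<Rightarrow> nat \<Rightarrow> real \<Rightarrow> real \<Rightarrow> real" where
  "grid_laplace c a n w z = (\<Prod>i<Suc n. (1 + w + z * grid a n i) powr (- (c / real (Suc n))))"

lemma grid_pos: "0 < grid a n i"
  by (simp add: grid_def)

lemma grid_0: "grid a n 0 = exp (- a)" and grid_last: "grid a n (Suc n) = 1"
  by (simp_all add: grid_def)

lemma grid_Suc: "grid a n (Suc i) = exp (a / real (Suc n)) * grid a n i"
  by (simp add: grid_def exp_add[symmetric] add_divide_distrib distrib_left)

lemma ln_grid: "ln (grid a n i) = - a + a * real i / real (Suc n)"
  by (simp add: grid_def)

lemma mono_grid: "0 \<le> a \<Longrightarrow> mono (grid a n)"
  by (intro monoI) (auto simp: grid_def divide_right_mono mult_left_mono)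

lemma mesh_ratio_tendsto: "(\<lambda>n. exp (a / real (Suc n))) \<longlonglongrightarrow> 1"
proof -
  have "(\<lambda>n. exp (a * inverse (real (Suc n)))) \<longlonglongrightarrow> exp (a * 0)"
    by (intro tendsto_intros LIMSEQ_inverse_real_of_nat)
  then show ?thesis by (simp add: divide_inverse)
qed

text \<open>Each factor \<open>1 + v + w + z * x\<close> is \<open>1 + v\<close> times the factor at the rescaled arguments. This is
  the identity that makes the total mass independent of the mean of the normalized measure.\<close>

lemma grid_laplace_tilt:
  assumes v: "0 \<le> v" and w: "0 \<le> w" and z: "0 \<le> z"
  shows "grid_laplace c a n (v + w) z =
    (1 + v) powr (- c) * grid_laplace c a n (w / (1 + v)) (z / (1 + v))"
proof -
  let ?p = "- (c / real (Suc n))"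
  have "(1 + (v + w) + z * grid a n i) powr ?p =
      (1 + v) powr ?p * (1 + w / (1 + v) + z / (1 + v) * grid a n i) powr ?p" for i
  proof -
    have "1 + (v + w) + z * grid a n i = (1 + v) * (1 + w / (1 + v) + z / (1 + v) * grid a n i)"
    proof -
      have "s * (1 + w / s + z / s * r) = s + w + z * r" if "s \<noteq> 0" for s r :: real
        using that by (simp add: field_simps)
      then show ?thesis using v by (simp add: add.assoc)
    qed
    moreover have "0 \<le> 1 + w / (1 + v) + z / (1 + v) * grid a n i"
      using assms less_imp_le[OF grid_pos] by (intro add_nonneg_nonneg mult_nonneg_nonneg) auto
    ultimately show ?thesis using v by (simp add: powr_mult)
  qed
  then have "grid_laplace c a n (v + w) z =
      ((1 + v) powr ?p) ^ Suc n * grid_laplace c a n (w / (1 + v)) (z / (1 + v))"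
    unfolding grid_laplace_def by (simp only: prod.distrib prod_constant card_lessThan)
  also have "((1 + v) powr ?p) ^ Suc n = (1 + v) powr (- c)"
    using v by (subst powr_power) (auto simp del: of_nat_Suc)
  finally show ?thesis .
qed

lemma sets_log_uniform [simp]: "sets (log_uniform a) = sets borel"
  by (simp add: log_uniform_def)

lemma emeasure_log_uniform_Ioc:
  assumes a: "0 < a" and uv: "exp (- a) \<le> u" "u \<le> v" "v \<le> 1"
  shows "emeasure (log_uniform a) {u<..v} = ennreal ((ln v - ln u) / a)"
proof -
  have u: "0 < u" using uv(1) exp_gt_zero[of "- a"] by linarith
  have "emeasure (log_uniform a) {u<..v} =
      (\<integral>\<^sup>+y. ennreal (indicator {exp (- a)..1} y / (a * y)) * indicator {u<..v} y \<partial>lborel)"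
    unfolding log_uniform_def by (subst emeasure_density) auto
  also have "\<dots> = (\<integral>\<^sup>+y. ennreal (1 / (a * y)) * indicator {u..v} y \<partial>lborel)"
  proof (rule nn_integral_cong_AE)
    show "AE y in lborel. ennreal (indicator {exp (- a)..1} y / (a * y)) * indicator {u<..v} y =
            ennreal (1 / (a * y)) * indicator {u..v} y"
      using AE_lborel_singleton[of u]
      by eventually_elim (use uv in \<open>auto split: split_indicator\<close>)
  qed
  also have "\<dots> = ennreal (ln v / a - ln u / a)"
  proof (rule nn_integral_FTC_Icc)
    fix x assume x: "x \<in> {u..v}"
    with u have "0 < x" by simp
    then show "((\<lambda>x. ln x / a) has_real_derivative (1 / (a * x))) (at x)"
      using x a by (auto intro!: derivative_eq_intros simp: field_simps)
    show "0 \<le> (1 / (a * x))"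
      using \<open>0 < x\<close> a by simp
  qed (use uv in auto)
  finally show ?thesis by (simp add: diff_divide_distrib)
qed

lemma emeasure_log_uniform_outside: "emeasure (log_uniform a) (- {exp (- a)<..1}) = 0"
proof -
  have "emeasure (log_uniform a) (- {exp (- a)<..1}) =
      (\<integral>\<^sup>+y. ennreal (indicator {exp (- a)..1} y / (a * y)) * indicator (- {exp (- a)<..1}) y \<partial>lborel)"
    unfolding log_uniform_def by (subst emeasure_density) auto
  also have "\<dots> = (\<integral>\<^sup>+(y::real). 0 \<partial>lborel)"
  proof (rule nn_integral_cong_AE)
    show "AE y in lborel. ennreal (indicator {exp (- a)..1} y / (a * y)) *
            indicator (- {exp (- a)<..1}) y = 0"
      using AE_lborel_singleton[of "exp (- a)"]
      by eventually_elim (auto split: split_indicator)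
  qed
  finally show ?thesis by simp
qed

text \<open>With total mass \<open>0\<close> the normalizing factor would be infinite; positivity makes it a real number.\<close>

lemma set_integral_normalize_measure:
  fixes g :: "'a \<Rightarrow> real"
  assumes "finite_measure \<mu>" and pos: "0 < measure \<mu> (space \<mu>)"
    and "B \<in> sets \<mu>" "g \<in> borel_measurable \<mu>"
  shows "(LINT x:B|normalize_measure \<mu>. g x) = (LINT x:B|\<mu>. g x) / measure \<mu> (space \<mu>)"
proof -
  interpret finite_measure \<mu> by fact
  let ?r = "1 / measure \<mu> (space \<mu>)"
  have "1 / emeasure \<mu> (space \<mu>) = ennreal ?r"
    using pos by (simp add: emeasure_eq_measure divide_ennreal[symmetric])
  then have "normalize_measure \<mu> = density \<mu> (\<lambda>_. ennreal ?r)"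
    unfolding normalize_measure_def
    by (intro measure_eqI) (auto simp: emeasure_density nn_integral_cmult_indicator)
  then show ?thesis
    unfolding set_lebesgue_integral_def using assms(3,4) pos
    by (simp add: integral_density)
qed

section \<open>The Gamma random measure with log-uniform shape\<close>

text \<open>The Gamma random measure from which the mean functional is formed. Its total mass and that
  functional turn out to be independent.\<close>

locale log_uniform_gamma_measure =
  gamma_random_measure N "scale_measure (ennreal (\<theta> * a)) (log_uniform a)" \<kappa>
  for N :: "'v measure" and \<theta> a :: real and \<kappa> :: "'v \<Rightarrow> real measure" +
  assumes pos: "0 < \<theta>" "0 < a"
begin

abbreviation "shape \<equiv> scale_measure (ennreal (\<theta> * a)) (log_uniform a)"
abbreviation "total_mass \<nu> \<equiv> measure (\<kappa> \<nu>) UNIV"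
abbreviation "cell n i \<equiv> {grid a n i<..grid a n (Suc i)}"

lemma sets_space_kappa: "\<nu> \<in> space N \<Longrightarrow> sets (\<kappa> \<nu>) = sets borel \<and> space (\<kappa> \<nu>) = UNIV"
  using sets_eq[of \<nu>] sets_eq_imp_space_eq[of "\<kappa> \<nu>" borel] by auto

lemma measure_cell:
  assumes "i < Suc n"
  shows "measure shape (cell n i) = \<theta> * a / real (Suc n)"
proof -
  have "grid a n 0 \<le> grid a n i" "grid a n i \<le> grid a n (Suc i)" "grid a n (Suc i) \<le> grid a n (Suc n)"
    using assms pos monoD[OF mono_grid[of a n]] by simp_all
  then have "emeasure (log_uniform a) (cell n i) = ennreal ((ln (grid a n (Suc i)) - ln (grid a n i)) / a)"
    using pos by (intro emeasure_log_uniform_Ioc) (simp_all only: grid_0 grid_last)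
  also have "(ln (grid a n (Suc i)) - ln (grid a n i)) / a = 1 / real (Suc n)"
  proof -
    have "ln (grid a n (Suc i)) - ln (grid a n i) = a / real (Suc n)"
      unfolding ln_grid by (simp add: add_divide_distrib distrib_left)
    then show ?thesis using pos by simp
  qed
  finally show ?thesis
    using pos by (simp add: measure_def ennreal_mult[symmetric] enn2real_ennreal)
qed

lemma AE_concentrated: "AE \<nu> in N. AE x in \<kappa> \<nu>. exp (- a) < x \<and> x \<le> 1"
proof -
  have "measure shape (- {exp (- a)<..1}) = 0"
    by (simp add: emeasure_log_uniform_outside measure_def)
  then have "AE \<nu> in N. measure (\<kappa> \<nu>) (- {exp (- a)<..1}) = 0"
    by (intro null_mass) simp_all
  then show ?thesis
    using AE_space
  proof eventually_elim
    case (elim \<nu>)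
    interpret \<kappa>: finite_measure "\<kappa> \<nu>" using finite_mass elim by simp
    have "- {exp (- a)<..1} \<in> null_sets (\<kappa> \<nu>)"
      using elim sets_space_kappa[of \<nu>] by (auto simp: null_sets_def \<kappa>.emeasure_eq_measure)
    then have "AE x in \<kappa> \<nu>. x \<notin> - {exp (- a)<..1}" by (rule AE_not_in)
    then show ?case by simp
  qed
qed

text \<open>On the cell above \<open>grid a n i\<close> the identity function varies only by the factor
  \<open>exp (a / Suc n)\<close>, and almost surely no mass lies outside the cells.\<close>

lemma AE_step_bounds:
  "AE \<nu> in N. total_mass \<nu> = (\<Sum>i<Suc n. measure (\<kappa> \<nu>) (cell n i)) \<and>
     (\<Sum>i<Suc n. grid a n i * measure (\<kappa> \<nu>) (cell n i)) \<le> (LINT x:{0..1}|\<kappa> \<nu>. x) \<and>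
     (LINT x:{0..1}|\<kappa> \<nu>. x) \<le> exp (a / real (Suc n)) * (\<Sum>i<Suc n. grid a n i * measure (\<kappa> \<nu>) (cell n i))"
  using AE_concentrated AE_space
proof eventually_elim
  case (elim \<nu>)
  interpret \<kappa>: finite_measure "\<kappa> \<nu>" using finite_mass elim by simp
  have sets: "sets (\<kappa> \<nu>) = sets borel" and space: "space (\<kappa> \<nu>) = UNIV"
    using sets_space_kappa elim by auto
  have mono: "mono (grid a n)" using pos by (intro mono_grid) simp
  have U: "(\<Union>i<Suc n. cell n i) = {exp (- a)<..1}"
    using UN_Ioc[OF mono, of "Suc n"] by (simp only: grid_0 grid_last)
  have conc: "AE x in \<kappa> \<nu>. x \<in> B \<longleftrightarrow> x \<in> (\<Union>i<Suc n. cell n i)" if "{exp (- a)<..1} \<subseteq> B" for B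
    unfolding U using elim(1) by eventually_elim (use that in auto)
  have sub: "{exp (- a)<..1} \<subseteq> {0..1}"
    using order_trans[OF exp_ge_zero[of "- a"]] by auto
  have cells: "cell n i \<in> sets (\<kappa> \<nu>)" for i by (simp add: sets)
  have disj: "disjoint_family_on (cell n) {..<Suc n}"
    using disjoint_family_Ioc[OF mono] .
  have "total_mass \<nu> = measure (\<kappa> \<nu>) (\<Union>i<Suc n. cell n i)"
    by (intro measure_eq_AE conc) (auto simp: sets)
  also have "\<dots> = (\<Sum>i<Suc n. measure (\<kappa> \<nu>) (cell n i))"
    using cells disj by (intro \<kappa>.finite_measure_finite_Union) auto
  finally have 1: "total_mass \<nu> = (\<Sum>i<Suc n. measure (\<kappa> \<nu>) (cell n i))" .
  have m: "(\<lambda>x. x) \<in> borel_measurable (\<kappa> \<nu>)"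
    by (rule measurable_ident_sets[OF sets])
  have fin: "emeasure (\<kappa> \<nu>) A \<noteq> \<infinity>" for A by simp
  have bounds: "grid a n i \<le> x \<and> x \<le> exp (a / real (Suc n)) * grid a n i"
    if "x \<in> cell n i" for i x
    using that by (auto simp only: grid_Suc greaterThanAtMost_iff)
  have B: "{0..1} \<in> sets (\<kappa> \<nu>)" by (simp add: sets)
  note * = set_integral_step_bounds[where x="grid a n" and y="\<lambda>i. exp (a / real (Suc n)) * grid a n i",
      OF cells fin disj B conc[OF sub] m bounds]
  show ?case
    using 1 *(1) *(2) unfolding sum_distrib_left mult.assoc by blast
qed

lemma AE_total_pos: "AE \<nu> in N. 0 < total_mass \<nu>"
proof -
  have "measure shape (cell 0 0) = \<theta> * a" using measure_cell[of 0 0] by simp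
  then have "distributed N lborel (\<lambda>\<nu>. measure (\<kappa> \<nu>) (cell 0 0)) (gamma_density (\<theta> * a))"
    using gamma_mass[of "cell 0 0"] pos by simp
  then have "AE \<nu> in N. 0 < measure (\<kappa> \<nu>) (cell 0 0)"
    by (rule gamma_variable_pos)
  then show ?thesis
    using AE_step_bounds[of 0] by eventually_elim simp
qed

text \<open>Almost surely the normalization can be undone, so the mean functional times the total mass is
  an integral with respect to \<open>\<kappa>\<close> itself, to which the step bounds apply.\<close>

lemma AE_total_mult_mean:
  "AE \<nu> in N. total_mass \<nu> * dirichlet_mean \<kappa> \<nu> = (LINT x:{0..1}|\<kappa> \<nu>. x)"
  using AE_total_pos AE_space
proof eventually_elim
  case (elim \<nu>)
  note s = sets_space_kappa[OF elim(2)]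
  have "(\<lambda>x. x) \<in> borel_measurable (\<kappa> \<nu>)"
    by (rule measurable_ident_sets[OF conjunct1[OF s]])
  then have "dirichlet_mean \<kappa> \<nu> = (LINT x:{0..1}|\<kappa> \<nu>. x) / measure (\<kappa> \<nu>) (space (\<kappa> \<nu>))"
    unfolding dirichlet_mean_def using elim s finite_mass
    by (intro set_integral_normalize_measure) auto
  then show ?case using elim s by simp
qed

text \<open>The step bounds for the partition into one single cell.\<close>

lemma AE_mean_bounds: "AE \<nu> in N. exp (- a) \<le> dirichlet_mean \<kappa> \<nu> \<and> dirichlet_mean \<kappa> \<nu> \<le> 1"
  using AE_total_mult_mean AE_total_pos AE_step_bounds[of 0]
proof eventually_elim
  case (elim \<nu>)
  have "exp (- a) * total_mass \<nu> \<le> total_mass \<nu> * dirichlet_mean \<kappa> \<nu>" "total_mass \<nu> * dirichlet_mean \<kappa> \<nu> \<le> total_mass \<nu>"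
    using elim by (simp_all add: grid_0 mult.assoc[symmetric] exp_add[symmetric])
  then show ?case using elim(2) by (simp add: mult.commute)
qed

lemma total_measurable: "total_mass \<in> borel_measurable N"
  using rv[of UNIV] by simp

lemma total_mean_laplace:
  assumes M: "dirichlet_mean \<kappa> \<in> borel_measurable N" and w: "0 \<le> w" and z: "0 \<le> z"
  shows "(\<lambda>n. grid_laplace (\<theta> * a) a n w z) \<longlonglongrightarrow>
     expectation (\<lambda>\<nu>. exp (- (w * total_mass \<nu> + z * (total_mass \<nu> * dirichlet_mean \<kappa> \<nu>))))"
  unfolding grid_laplace_def
proof (rule laplace_limit_of_step_approximation[where D="\<lambda>n i \<nu>. measure (\<kappa> \<nu>) (cell n i)"
      and q="\<lambda>n. exp (a / real (Suc n))"])
  show "indep_vars (\<lambda>_. borel) (\<lambda>i \<nu>. measure (\<kappa> \<nu>) (cell n i)) {..<Suc n}" for n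
    using pos by (intro indep_masses disjoint_family_Ioc mono_grid) auto
  show "expectation (\<lambda>\<nu>. exp (- t * measure (\<kappa> \<nu>) (cell n i))) = (1 + t) powr (- (\<theta> * a / real (Suc n)))"
    if "i < Suc n" "0 \<le> t" for n i t
  proof (rule gamma_variable_laplace)
    show "0 < \<theta> * a / real (Suc n)" using pos by simp
    then show "distributed N lborel (\<lambda>\<nu>. measure (\<kappa> \<nu>) (cell n i)) (gamma_density (\<theta> * a / real (Suc n)))"
      using gamma_mass[of "cell n i"] unfolding measure_cell[OF that(1)] by simp
  qed fact
  show "AE \<nu> in N. total_mass \<nu> = (\<Sum>i<Suc n. measure (\<kappa> \<nu>) (cell n i))" for n
    using AE_step_bounds[of n] by eventually_elim simp
  show "AE \<nu> in N. (\<Sum>i<Suc n. grid a n i * measure (\<kappa> \<nu>) (cell n i)) \<le> total_mass \<nu> * dirichlet_mean \<kappa> \<nu> \<and>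
      total_mass \<nu> * dirichlet_mean \<kappa> \<nu> \<le> exp (a / real (Suc n)) * (\<Sum>i<Suc n. grid a n i * measure (\<kappa> \<nu>) (cell n i))" for n
    using AE_step_bounds[of n] AE_total_mult_mean by eventually_elim simp
  show "(\<lambda>\<nu>. total_mass \<nu> * dirichlet_mean \<kappa> \<nu>) \<in> borel_measurable N"
    using M total_measurable by measurable
  show "0 \<le> grid a n i" for n i
    using grid_pos less_imp_le by blast
qed (use mesh_ratio_tendsto total_measurable w z in auto)

text \<open>The total mass is independent of the mean functional: the tilting identity of the approximating
  products survives in the limit.\<close>

lemma laplace_total_mean_factorizes:
  assumes M: "dirichlet_mean \<kappa> \<in> borel_measurable N" and w: "0 \<le> w"
  shows "expectation (\<lambda>\<nu>. exp (- (w * total_mass \<nu> + z * dirichlet_mean \<kappa> \<nu>))) =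
         (1 + w) powr (- (\<theta> * a)) * expectation (\<lambda>\<nu>. exp (- (z * dirichlet_mean \<kappa> \<nu>)))"
proof -
  let ?M = "dirichlet_mean \<kappa>"
  note [measurable] = M total_measurable
  have "expectation (\<lambda>\<nu>. exp (- (w * total_mass \<nu> + z * (total_mass \<nu> * ?M \<nu> / total_mass \<nu>)))) =
      (1 + w) powr (- (\<theta> * a)) * expectation (\<lambda>\<nu>. exp (- (z * (total_mass \<nu> * ?M \<nu> / total_mass \<nu>))))"
  proof (rule scale_tilting_ratio_laplace[OF _ _ _ _ w])
    show "AE \<nu> in N. 0 \<le> total_mass \<nu> \<and> 0 \<le> total_mass \<nu> * ?M \<nu>"
      using AE_mean_bounds
    proof eventually_elim
      case (elim \<nu>)
      then have "0 \<le> ?M \<nu>" using exp_ge_zero[of "- a"] by linarith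
      then show ?case by simp
    qed
    fix v w z :: real assume nn: "0 \<le> v" "0 \<le> w" "0 \<le> z"
    have "(\<lambda>n. grid_laplace (\<theta> * a) a n (v + w) z) \<longlonglongrightarrow> (1 + v) powr (- (\<theta> * a)) *
        expectation (\<lambda>\<nu>. exp (- (w / (1 + v) * total_mass \<nu> + z / (1 + v) * (total_mass \<nu> * ?M \<nu>))))"
      unfolding grid_laplace_tilt[OF nn]
      using nn by (intro tendsto_mult_left total_mean_laplace M) auto
    then show "expectation (\<lambda>\<nu>. exp (- ((v + w) * total_mass \<nu> + z * (total_mass \<nu> * ?M \<nu>)))) =
      (1 + v) powr (- (\<theta> * a)) *
        expectation (\<lambda>\<nu>. exp (- (w / (1 + v) * total_mass \<nu> + z / (1 + v) * (total_mass \<nu> * ?M \<nu>))))"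
      using total_mean_laplace[OF M, of "v + w" z] nn by (intro LIMSEQ_unique) auto
  qed measurable
  moreover have "AE \<nu> in N. total_mass \<nu> * ?M \<nu> / total_mass \<nu> = ?M \<nu>"
    using AE_total_pos by eventually_elim simp
  then have "expectation (\<lambda>\<nu>. exp (- (w * total_mass \<nu> + z * (total_mass \<nu> * ?M \<nu> / total_mass \<nu>)))) =
        expectation (\<lambda>\<nu>. exp (- (w * total_mass \<nu> + z * ?M \<nu>)))"
      "expectation (\<lambda>\<nu>. exp (- (z * (total_mass \<nu> * ?M \<nu> / total_mass \<nu>)))) = expectation (\<lambda>\<nu>. exp (- (z * ?M \<nu>)))"
    by (auto intro!: integral_cong_AE)
  ultimately show ?thesis by simp
qed

text \<open>The total mass may be replaced by any independent variable with the same Gamma law, because the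
  joint Laplace transforms factorize in the same way.\<close>

lemma independent_total_law:
  assumes T: "distributed N lborel T (gamma_density (\<theta> * a))"
    and indep: "indep_var borel T borel (dirichlet_mean \<kappa>)"
  shows "distr N (borel \<Otimes>\<^sub>M borel) (\<lambda>\<nu>. (T \<nu>, dirichlet_mean \<kappa> \<nu>)) =
         distr N (borel \<Otimes>\<^sub>M borel) (\<lambda>\<nu>. (total_mass \<nu>, dirichlet_mean \<kappa> \<nu>))"
proof (rule joint_distr_eqI_laplace)
  let ?M = "dirichlet_mean \<kappa>"
  have [measurable]: "T \<in> borel_measurable N" "?M \<in> borel_measurable N"
    using indep_var_rv1[OF indep] indep_var_rv2[OF indep] by auto
  have M_nonneg: "AE \<nu> in N. 0 \<le> ?M \<nu>"
    using AE_mean_bounds by eventually_elim (use exp_ge_zero[of "- a"] in linarith)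
  have T_nonneg: "AE \<nu> in N. 0 \<le> T \<nu>"
    using gamma_variable_pos[OF T] by eventually_elim simp
  show "AE \<nu> in N. 0 \<le> T \<nu> \<and> 0 \<le> ?M \<nu>"
    using M_nonneg T_nonneg by eventually_elim simp
  show "AE \<nu> in N. 0 \<le> total_mass \<nu> \<and> 0 \<le> ?M \<nu>"
    using M_nonneg by eventually_elim simp
  show "T \<in> borel_measurable N" "?M \<in> borel_measurable N" "?M \<in> borel_measurable N"
    "total_mass \<in> borel_measurable N" "prob_space N" "prob_space N"
    using total_measurable prob_space_axioms by measurable
  fix m n :: nat
  have int: "integrable N (\<lambda>\<nu>. exp (- real k * X \<nu>))"
    if "X \<in> borel_measurable N" "AE \<nu> in N. 0 \<le> X \<nu>" for X :: "'v \<Rightarrow> real" and k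
    \<comment> \<open>The unqualified fact of this name belongs to the shape measure, which is finite as well.\<close>
  proof (rule finite_measure.integrable_const_bound[where B=1,
        OF prob_space.finite_measure[OF prob_space_axioms]])
    show "AE \<nu> in N. norm (exp (- real k * X \<nu>)) \<le> 1"
      using that(2) by eventually_elim simp
  qed (use that(1) in measurable)
  have "expectation (\<lambda>\<nu>. exp (- (real m * T \<nu> + real n * ?M \<nu>))) =
      expectation (\<lambda>\<nu>. exp (- real m * T \<nu>) * exp (- real n * ?M \<nu>))"
    by (simp add: exp_add[symmetric])
  also have "\<dots> = expectation (\<lambda>\<nu>. exp (- real m * T \<nu>)) * expectation (\<lambda>\<nu>. exp (- real n * ?M \<nu>))"
  proof (rule indep_var_lebesgue_integral)
    show "indep_var borel (\<lambda>\<nu>. exp (- real m * T \<nu>)) borel (\<lambda>\<nu>. exp (- real n * ?M \<nu>))"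
      using indep_var_compose[OF indep, of "\<lambda>t. exp (- real m * t)" borel "\<lambda>t. exp (- real n * t)" borel]
      by (simp add: comp_def)
    show "integrable N (\<lambda>\<nu>. exp (- real m * T \<nu>))"
      by (rule int[OF _ T_nonneg]) measurable
    show "integrable N (\<lambda>\<nu>. exp (- real n * ?M \<nu>))"
      by (rule int[OF _ M_nonneg]) measurable
  qed
  also have "expectation (\<lambda>\<nu>. exp (- real m * T \<nu>)) = (1 + real m) powr (- (\<theta> * a))"
    using pos by (intro gamma_variable_laplace T) auto
  finally show "expectation (\<lambda>\<nu>. exp (- (real m * T \<nu> + real n * ?M \<nu>))) =
      expectation (\<lambda>\<nu>. exp (- (real m * total_mass \<nu> + real n * ?M \<nu>)))"
    using laplace_total_mean_factorizes[of "real m" "real n"] by simp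
qed

end

section \<open>The Gamma process\<close>

context gamma_process
begin

text \<open>The distribution function of the random measure of the process, constant on the negative axis.\<close>

abbreviation "extended_path \<omega> s \<equiv> G (max 0 s) \<omega>"
abbreviation "time a n i \<equiv> a * real i / real (Suc n)"
abbreviation "increment a n i \<omega> \<equiv> G (time a n (Suc i)) \<omega> - G (time a n i) \<omega>"

lemma extended_path_mono: "\<omega> \<in> space M \<Longrightarrow> s \<le> t \<Longrightarrow> extended_path \<omega> s \<le> extended_path \<omega> t"
  by (intro paths_mono) auto

lemma extended_path_right_continuous:
  assumes "\<omega> \<in> space M"
  shows "continuous (at_right t) (extended_path \<omega>)"
proof (cases "0 \<le> t")
  case True
  have "((\<lambda>s. G s \<omega>) \<longlongrightarrow> G t \<omega>) (at_right t)"
    using paths_right_continuous[OF assms True] by (simp add: continuous_within)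
  moreover have "eventually (\<lambda>s. extended_path \<omega> s = G s \<omega>) (at_right t)"
    using True by (auto simp: eventually_at_filter intro!: always_eventually)
  ultimately show ?thesis
    using True by (simp add: continuous_within tendsto_cong)
next
  case False
  then have "eventually (\<lambda>s. s < 0) (at_right t)"
    by (intro order_tendstoD(2)[OF tendsto_ident_at]) auto
  then have "eventually (\<lambda>s. extended_path \<omega> s = G 0 \<omega>) (at_right t)"
    by eventually_elim simp
  then show ?thesis
    using False by (simp add: continuous_within tendsto_eventually)
qed

lemma emeasure_process_Ioc:
  assumes "\<omega> \<in> space M" "s \<le> t"
  shows "emeasure (process_measure G \<omega>) {s<..t} = ennreal (extended_path \<omega> t - extended_path \<omega> s)"
  unfolding process_measure_def
  using assms extended_path_mono extended_path_right_continuous by (intro emeasure_interval_measure_Ioc) auto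

lemma measure_process_Ioc:
  assumes "\<omega> \<in> space M" "0 \<le> s" "s \<le> t"
  shows "measure (process_measure G \<omega>) {s<..t} = G t \<omega> - G s \<omega>"
  using emeasure_process_Ioc[OF assms(1,3)] extended_path_mono[OF assms(1,3)] assms by (simp add: measure_def)

lemma sets_process [simp]: "sets (process_measure G \<omega>) = sets borel"
  by (simp add: process_measure_def)

text \<open>The point \<open>0\<close> carries no mass, since the distribution function is constant to its left and
  continuous from the left there.\<close>

lemma AE_process_Icc_Ioc:
  assumes "\<omega> \<in> space M"
  shows "AE s in process_measure G \<omega>. s \<in> {0..t} \<longleftrightarrow> s \<in> {0<..t}"
proof -
  have "emeasure (process_measure G \<omega>) {-1<..0} = 0"
    using emeasure_process_Ioc[OF assms, of "-1" 0] by simp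
  then have "{-1<..0} \<in> null_sets (process_measure G \<omega>)" by auto
  then have "AE s in process_measure G \<omega>. s \<notin> {-1<..0}" by (rule AE_not_in)
  then show ?thesis by eventually_elim auto
qed

lemma emeasure_process_Icc_finite:
  assumes "\<omega> \<in> space M"
  shows "emeasure (process_measure G \<omega>) {0..t} \<noteq> \<infinity>"
proof -
  have "emeasure (process_measure G \<omega>) {0..t} = emeasure (process_measure G \<omega>) {0<..t}"
    using AE_process_Icc_Ioc[OF assms] by (intro emeasure_eq_AE) auto
  also have "\<dots> \<noteq> \<infinity>"
    using emeasure_process_Ioc[OF assms, of 0 t] by (cases "0 \<le> t") auto
  finally show ?thesis .
qed

lemma process_integral_bounds:
  assumes \<omega>: "\<omega> \<in> space M" and a: "0 < a" and g: "g \<in> borel_measurable borel"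
    and bounds: "\<And>i s. i < Suc n \<Longrightarrow> s \<in> {time a n i<..time a n (Suc i)} \<Longrightarrow> x i \<le> g s \<and> g s \<le> y i"
  shows "(\<Sum>i<Suc n. x i * increment a n i \<omega>) \<le> (LINT s:{0..a}|process_measure G \<omega>. g s)"
    and "(LINT s:{0..a}|process_measure G \<omega>. g s) \<le> (\<Sum>i<Suc n. y i * increment a n i \<omega>)"
proof -
  let ?A = "\<lambda>i. {time a n i<..time a n (Suc i)}"
  have mono: "mono (time a n)"
    using a by (intro monoI) (auto intro!: divide_right_mono)
  have U: "(\<Union>i<Suc n. ?A i) = {0<..a}"
    using UN_Ioc[OF mono, of "Suc n"] by simp
  have le: "time a n i \<le> time a n (Suc i)" "0 \<le> time a n i" for i
    using monoD[OF mono, of i "Suc i"] a by auto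
  have m: "measure (process_measure G \<omega>) (?A i) = increment a n i \<omega>" for i
    by (rule measure_process_Ioc[OF \<omega> le(2,1)])
  have fin: "emeasure (process_measure G \<omega>) (?A i) \<noteq> \<infinity>" for i
    using emeasure_process_Ioc[OF \<omega> le(1)] by simp
  have sets: "?A i \<in> sets (process_measure G \<omega>)" for i by simp
  have B: "{0..a} \<in> sets (process_measure G \<omega>)" by simp
  have g': "g \<in> borel_measurable (process_measure G \<omega>)"
    using g measurable_cong_sets[OF sets_process refl] by blast
  note * = set_integral_step_bounds[where x=x and y=y, OF sets fin disjoint_family_Ioc[OF mono] B
      AE_process_Icc_Ioc[OF \<omega>, of a, folded U] g' bounds, unfolded m]
  show "(\<Sum>i<Suc n. x i * increment a n i \<omega>) \<le> (LINT s:{0..a}|process_measure G \<omega>. g s)"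
    "(LINT s:{0..a}|process_measure G \<omega>. g s) \<le> (\<Sum>i<Suc n. y i * increment a n i \<omega>)"
    using *(1,2) by blast+
qed

lemma process_integral_one:
  assumes "\<omega> \<in> space M" "0 < a"
  shows "(LINT s:{0..a}|process_measure G \<omega>. 1) = G a \<omega>"
  using process_integral_bounds[OF assms, of "\<lambda>_. 1" 0 "\<lambda>_. 1" "\<lambda>_. 1"] start_zero[OF assms(1)]
  by simp

abbreviation "exp_integral a \<omega> \<equiv> (LINT s:{0..a}|process_measure G \<omega>. exp (s - a))"

lemma process_step_bounds:
  assumes "\<omega> \<in> space M" "0 < a"
  shows "(\<Sum>i<Suc n. grid a n i * increment a n i \<omega>) \<le> exp_integral a \<omega>"
    and "exp_integral a \<omega> \<le> exp (a / real (Suc n)) * (\<Sum>i<Suc n. grid a n i * increment a n i \<omega>)"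
proof -
  have "grid a n i \<le> exp (s - a) \<and> exp (s - a) \<le> grid a n (Suc i)"
    if "s \<in> {time a n i<..time a n (Suc i)}" for i s
    using that by (simp add: grid_def)
  note * = process_integral_bounds[where n=n and g="\<lambda>s. exp (s - a)" and x="grid a n"
      and y="\<lambda>i. grid a n (Suc i)", OF assms _ this, unfolded grid_Suc mult.assoc]
  show "(\<Sum>i<Suc n. grid a n i * increment a n i \<omega>) \<le> exp_integral a \<omega>"
    by (rule *(1)) auto
  show "exp_integral a \<omega> \<le> exp (a / real (Suc n)) * (\<Sum>i<Suc n. grid a n i * increment a n i \<omega>)"
    unfolding sum_distrib_left by (rule *(2)) auto
qed

lemma increment_measurable: "0 < a \<Longrightarrow> increment a n i \<in> borel_measurable M"
  using rv by (intro borel_measurable_diff) auto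

text \<open>For each outcome the step sums, which are measurable, converge to the integral.\<close>

lemma exp_integral_measurable:
  assumes "0 < a"
  shows "exp_integral a \<in> borel_measurable M"
proof (rule borel_measurable_LIMSEQ_real)
  fix \<omega> assume "\<omega> \<in> space M"
  then show "(\<lambda>n. \<Sum>i<Suc n. grid a n i * increment a n i \<omega>) \<longlonglongrightarrow> exp_integral a \<omega>"
    using process_step_bounds[OF _ assms]
    by (intro tendsto_of_relative_bounds[OF _ _ mesh_ratio_tendsto]) auto
next
  show "(\<lambda>\<omega>. \<Sum>i<Suc n. grid a n i * increment a n i \<omega>) \<in> borel_measurable M" for n
    using increment_measurable[OF assms] by (intro borel_measurable_sum borel_measurable_times) auto
qed

text \<open>The same limit as for the Gamma random measure with log-uniform shape: the increments over equal
  time steps have the law of the masses of the cells, and the integrand \<open>exp (s - a)\<close> runs through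
  the same grid values.\<close>

lemma process_laplace:
  assumes a: "0 < a" and w: "0 \<le> w" and z: "0 \<le> z"
  shows "(\<lambda>n. grid_laplace (\<theta> * a) a n w z) \<longlonglongrightarrow>
     expectation (\<lambda>\<omega>. exp (- (w * G a \<omega> + z * exp_integral a \<omega>)))"
  unfolding grid_laplace_def
proof (rule laplace_limit_of_step_approximation[where D="\<lambda>n i. increment a n i"
      and q="\<lambda>n. exp (a / real (Suc n))"])
  have le: "time a n i \<le> time a n (Suc i)" "0 \<le> time a n i" for n i
    using a by (auto intro!: divide_right_mono)
  show "indep_vars (\<lambda>_. borel) (\<lambda>i. increment a n i) {..<Suc n}" for n
    by (rule indep_increments[where t="time a n"]) (use le in auto)
  show "expectation (\<lambda>\<omega>. exp (- t * increment a n i \<omega>)) = (1 + t) powr (- (\<theta> * a / real (Suc n)))"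
    if "0 \<le> t" for n i t
  proof -
    have d: "time a n (Suc i) - time a n i = a / real (Suc n)"
      by (simp add: diff_divide_distrib[symmetric] algebra_simps)
    have "expectation (\<lambda>\<omega>. exp (- t * increment a n i \<omega>)) =
        (\<integral>x. exp (- t * x) \<partial>distr M borel (increment a n i))"
      using increment_measurable[OF a] by (subst integral_distr) auto
    also have "\<dots> = (\<integral>x. exp (- t * x) \<partial>distr M borel (G (a / real (Suc n))))"
      by (simp only: stationary_increments[OF le(2,1)] d)
    also have "\<dots> = expectation (\<lambda>\<omega>. exp (- t * G (a / real (Suc n)) \<omega>))"
      using rv a by (subst integral_distr) auto
    also have "\<dots> = (1 + t) powr (- \<theta> * (a / real (Suc n)))"
      using a that by (intro laplace) auto
    finally show ?thesis by simp
  qed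
  show "AE \<omega> in M. 0 \<le> increment a n i \<omega>" for n i
    using AE_space by eventually_elim (use paths_mono[OF _ le(2,1)] in simp)
  show "AE \<omega> in M. G a \<omega> = (\<Sum>i<Suc n. increment a n i \<omega>)" for n
    using AE_space
  proof eventually_elim
    case (elim \<omega>)
    have "(\<Sum>i<Suc n. increment a n i \<omega>) = G (time a n (Suc n)) \<omega> - G (time a n 0) \<omega>"
      by (rule sum_lessThan_telescope)
    then show ?case using start_zero[OF elim] by simp
  qed
  show "AE \<omega> in M. (\<Sum>i<Suc n. grid a n i * increment a n i \<omega>) \<le> exp_integral a \<omega> \<and>
      exp_integral a \<omega> \<le> exp (a / real (Suc n)) * (\<Sum>i<Suc n. grid a n i * increment a n i \<omega>)" for n
    using AE_space by eventually_elim (use process_step_bounds[OF _ a] in blast)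
  show "0 \<le> grid a n i" for n i
    using grid_pos less_imp_le by blast
  show "G a \<in> borel_measurable M" using rv a by simp
  show "exp_integral a \<in> borel_measurable M" using exp_integral_measurable[OF a] .
qed (use mesh_ratio_tendsto w z in auto)

lemma exp_integral_nonneg: "0 \<le> exp_integral a \<omega>"
  unfolding set_lebesgue_integral_def by (rule Bochner_Integration.integral_nonneg) simp

end

section \<open>Equality in joint distribution\<close>

lemma eq_in_distr_compose:
  assumes eq: "eq_in_distr P X Q Y S" and f: "f \<in> measurable S R"
  shows "eq_in_distr P (\<lambda>\<omega>. f (X \<omega>)) Q (\<lambda>\<nu>. f (Y \<nu>)) R"
proof -
  have X: "X \<in> measurable P S" and Y: "Y \<in> measurable Q S" and "distr P S X = distr Q S Y"
    using eq by (auto simp: eq_in_distr_def)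
  then have "distr P R (f \<circ> X) = distr Q R (f \<circ> Y)"
    using f by (simp add: distr_distr[symmetric])
  then show ?thesis
    using measurable_compose[OF X f] measurable_compose[OF Y f]
    by (simp add: eq_in_distr_def comp_def)
qed

text \<open>Equal limits give equal joint Laplace transforms of (value, integral) for the process and of
  (total mass, total mass times mean) for the random measure. Independence then permits exchanging
  the total mass for \<open>T\<close>.\<close>

lemma gamma_process_log_uniform_eq_in_distr:
  assumes G: "gamma_process \<Omega> \<theta> G" and K: "log_uniform_gamma_measure N \<theta> a \<kappa>"
    and T: "distributed N lborel T (gamma_density (\<theta> * a))"
    and indep: "prob_space.indep_var N borel T borel (dirichlet_mean \<kappa>)"
  shows "eq_in_distr \<Omega> (\<lambda>\<omega>. (G a \<omega>, LINT s:{0..a}|process_measure G \<omega>. exp (s - a)))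
           N (\<lambda>\<nu>. (T \<nu>, T \<nu> * dirichlet_mean \<kappa> \<nu>)) (borel \<Otimes>\<^sub>M borel)"
proof -
  interpret G: gamma_process \<Omega> \<theta> G by fact
  interpret K: log_uniform_gamma_measure N \<theta> a \<kappa> by fact
  let ?M = "dirichlet_mean \<kappa>" and ?B = "borel \<Otimes>\<^sub>M borel :: (real \<times> real) measure"
  let ?f = "\<lambda>(x, m). (x, x * m) :: real \<times> real"
  have a: "0 < a" by (rule K.pos)
  have [measurable]: "T \<in> borel_measurable N" "?M \<in> borel_measurable N"
    using K.indep_var_rv1[OF indep] K.indep_var_rv2[OF indep] by auto
  note [measurable] = K.total_measurable G.exp_integral_measurable[OF a]
  have Ga[measurable]: "G a \<in> borel_measurable \<Omega>" using G.rv a by simp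
  have "distr \<Omega> ?B (\<lambda>\<omega>. (G a \<omega>, G.exp_integral a \<omega>)) = distr N ?B (\<lambda>\<nu>. (K.total_mass \<nu>, K.total_mass \<nu> * ?M \<nu>))"
  proof (rule joint_distr_eqI_laplace[OF G.prob_space_axioms K.prob_space_axioms])
    show "AE \<omega> in \<Omega>. 0 \<le> G a \<omega> \<and> 0 \<le> G.exp_integral a \<omega>"
      using AE_space
    proof eventually_elim
      case (elim \<omega>)
      show ?case
        using G.paths_mono[OF elim, of 0 a] G.start_zero[OF elim] G.exp_integral_nonneg a by simp
    qed
    show "AE \<nu> in N. 0 \<le> K.total_mass \<nu> \<and> 0 \<le> K.total_mass \<nu> * ?M \<nu>"
      using K.AE_mean_bounds
    proof eventually_elim
      case (elim \<nu>)
      then have "0 \<le> ?M \<nu>" using exp_ge_zero[of "- a"] by linarith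
      then show ?case by simp
    qed
    fix m n :: nat
    show "(\<integral>\<omega>. exp (- (real m * G a \<omega> + real n * G.exp_integral a \<omega>)) \<partial>\<Omega>) =
        (\<integral>\<nu>. exp (- (real m * K.total_mass \<nu> + real n * (K.total_mass \<nu> * ?M \<nu>))) \<partial>N)"
      by (rule LIMSEQ_unique[OF G.process_laplace K.total_mean_laplace]) (use a in auto)
  qed measurable
  also have "\<dots> = distr (distr N ?B (\<lambda>\<nu>. (K.total_mass \<nu>, ?M \<nu>))) ?B ?f"
    by (subst distr_distr) (auto simp: comp_def)
  also have "\<dots> = distr (distr N ?B (\<lambda>\<nu>. (T \<nu>, ?M \<nu>))) ?B ?f"
    by (simp only: K.independent_total_law[OF T indep])
  also have "\<dots> = distr N ?B (\<lambda>\<nu>. (T \<nu>, T \<nu> * ?M \<nu>))"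
    by (subst distr_distr) (auto simp: comp_def)
  finally show ?thesis
    unfolding eq_in_distr_def by (intro conjI) measurable
qed

theorem proposition3p1:
  fixes \<Omega> :: "'w measure" and N :: "'v measure"
    and \<theta> l \<Delta> a :: real
    and G :: "real \<Rightarrow> 'w \<Rightarrow> real" and Y :: "'w \<Rightarrow> real"
    and \<kappa> :: "'v \<Rightarrow> real measure" and T M :: "'v \<Rightarrow> real"
  assumes pos: "0 < \<theta>" "0 < l" "0 < \<Delta>"
    and a: "a = l * \<Delta>"
    and G: "gamma_process \<Omega> \<theta> G"
    and Y: "Y = (\<lambda>\<omega>. exp (- a) * scaled_integral G l \<Delta> (\<lambda>y. exp (l * y)) \<omega>)"
    and \<kappa>: "gamma_random_measure N (scale_measure (ennreal (\<theta> * a)) (log_uniform a)) \<kappa>"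
    and M: "M = dirichlet_mean \<kappa>"
    and T: "distributed N lborel T (gamma_density (\<theta> * a))"
    and indep: "prob_space.indep_var N borel T borel M"
  shows
    "(\<forall>\<omega>\<in>space \<Omega>. G a \<omega> = scaled_integral G l \<Delta> (\<lambda>y. 1) \<omega>) \<and>
     eq_in_distr \<Omega> (G a) N T borel \<and>
     \<comment> \<open>(i)\<close>
     eq_in_distr \<Omega> (\<lambda>\<omega>. (G a \<omega>, Y \<omega>)) N (\<lambda>\<nu>. (T \<nu>, T \<nu> * M \<nu>)) (borel \<Otimes>\<^sub>M borel) \<and>
     (AE \<nu> in N. exp (- a) \<le> M \<nu> \<and> M \<nu> \<le> 1) \<and>
     \<comment> \<open>(ii)\<close>
     (\<forall>\<omega>\<in>space \<Omega>. scaled_integral G l \<Delta> (\<lambda>y. 1 - exp (- l * (\<Delta> - y))) \<omega> = G a \<omega> - Y \<omega>) \<and>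
     eq_in_distr \<Omega> (\<lambda>\<omega>. G a \<omega> - Y \<omega>) N (\<lambda>\<nu>. T \<nu> * (1 - M \<nu>)) borel \<and>
     \<comment> \<open>(iii)\<close>
     eq_in_distr \<Omega> (\<lambda>\<omega>. (G a \<omega> - Y \<omega>, Y \<omega>)) N
       (\<lambda>\<nu>. (T \<nu> * (1 - M \<nu>), T \<nu> * M \<nu>)) (borel \<Otimes>\<^sub>M borel)"
proof -
  interpret G: gamma_process \<Omega> \<theta> G by fact
  have a_pos: "0 < a" using pos a by simp
  interpret K: log_uniform_gamma_measure N \<theta> a \<kappa>
    using \<kappa> pos a_pos by (intro log_uniform_gamma_measure.intro log_uniform_gamma_measure_axioms.intro)
  have scaled: "scaled_integral G l \<Delta> g \<omega> = (LINT s:{0..a}|process_measure G \<omega>. g (s / l))" for g \<omega>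
    by (simp add: scaled_integral_def a)
  have Y': "Y \<omega> = G.exp_integral a \<omega>" for \<omega>
  proof -
    have "Y \<omega> = (LINT s:{0..a}|process_measure G \<omega>. exp (- a) * exp (l * (s / l)))"
      unfolding Y scaled by simp
    also have "(\<lambda>s. exp (- a) * exp (l * (s / l))) = (\<lambda>s. exp (s - a))"
      using pos by (simp add: exp_add[symmetric])
    finally show ?thesis .
  qed
  have total: "G a \<omega> = scaled_integral G l \<Delta> (\<lambda>y. 1) \<omega>" if "\<omega> \<in> space \<Omega>" for \<omega>
    unfolding scaled using G.process_integral_one[OF that a_pos] by simp
  have complement: "scaled_integral G l \<Delta> (\<lambda>y. 1 - exp (- l * (\<Delta> - y))) \<omega> = G a \<omega> - Y \<omega>"
    if "\<omega> \<in> space \<Omega>" for \<omega>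
  proof -
    have "(\<lambda>s. 1 - exp (- l * (\<Delta> - s / l))) = (\<lambda>s. 1 - exp (s - a))"
      using pos by (simp add: a right_diff_distrib)
    then have "scaled_integral G l \<Delta> (\<lambda>y. 1 - exp (- l * (\<Delta> - y))) \<omega> =
        (LINT s:{0..a}|process_measure G \<omega>. 1 - exp (s - a))"
      unfolding scaled by simp
    also have "\<dots> = (LINT s:{0..a}|process_measure G \<omega>. 1) - G.exp_integral a \<omega>"
    proof (rule set_integral_diff(2))
      have fin: "{0..a} \<in> sets (process_measure G \<omega>)" by simp
      show "set_integrable (process_measure G \<omega>) {0..a} (\<lambda>_. 1 :: real)"
        by (rule set_integrable_bounded[OF fin G.emeasure_process_Icc_finite[OF that], where b=1]) auto
      have "(\<lambda>s. exp (s - a)) \<in> borel_measurable (process_measure G \<omega>)"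
        by (subst measurable_cong_sets[OF G.sets_process refl]) measurable
      then show "set_integrable (process_measure G \<omega>) {0..a} (\<lambda>s. exp (s - a))"
        by (rule set_integrable_bounded[OF fin G.emeasure_process_Icc_finite[OF that], where b=1]) auto
    qed
    finally show ?thesis
      by (simp only: G.process_integral_one[OF that a_pos] Y')
  qed
  have joint: "eq_in_distr \<Omega> (\<lambda>\<omega>. (G a \<omega>, Y \<omega>)) N (\<lambda>\<nu>. (T \<nu>, T \<nu> * M \<nu>)) (borel \<Otimes>\<^sub>M borel)"
    unfolding Y' M
    by (rule gamma_process_log_uniform_eq_in_distr[OF G K.log_uniform_gamma_measure_axioms T
          indep[unfolded M]])
  have TM: "T \<nu> * (1 - M \<nu>) = T \<nu> - T \<nu> * M \<nu>" for \<nu>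
    by (simp add: right_diff_distrib)
  have "eq_in_distr \<Omega> (G a) N T borel"
    using eq_in_distr_compose[OF joint, of fst borel] by simp
  moreover have "eq_in_distr \<Omega> (\<lambda>\<omega>. G a \<omega> - Y \<omega>) N (\<lambda>\<nu>. T \<nu> * (1 - M \<nu>)) borel"
    unfolding TM using eq_in_distr_compose[OF joint, of "\<lambda>p. fst p - snd p" borel] by simp
  moreover have "eq_in_distr \<Omega> (\<lambda>\<omega>. (G a \<omega> - Y \<omega>, Y \<omega>)) N
       (\<lambda>\<nu>. (T \<nu> * (1 - M \<nu>), T \<nu> * M \<nu>)) (borel \<Otimes>\<^sub>M borel)"
    unfolding TM
    using eq_in_distr_compose[OF joint, of "\<lambda>p. (fst p - snd p, snd p)" "borel \<Otimes>\<^sub>M borel"] by simp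
  ultimately show ?thesis
    using joint total complement K.AE_mean_bounds unfolding M by blast
qed

end
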